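(* Let $X\sim\operatorname{GP}_S(\sigma,(\gamma_1,\dots,\gamma_d),\mathcal L(S))$ be a $d$-variate generalized Pareto random vector with $\gamma_1=\dots=\gamma_d=:\gamma\in\mathbb R$. Let $A=(a_{i,j})\in[0,\infty)^{m\times d}$, with $i$-th row denoted $A_i$, be such that $\Pr[A_iX>0]>0$ for all $i=1,\dots,m$. For $x\in\mathbb R^m$ such that $A_i\sigma+\gamma x_i>0$ for all $i=1,\dots,m$, we have $$\Pr[AX\not\le x]=\mathbb E\Bigl[1\wedge\max_{i=1,\dots,m}\bigl\{\bigl(1+\gamma x_i/(A_i\sigma)\bigr)^{-1/\gamma}\,e^{U_i}\bigr\}\Bigr],$$ where $U=(U_1,\dots,U_m)$ is given by $$U_i=\begin{cases}\gamma^{-1}\log\bigl(\sum_{j=1}^dp_{i,j}\,e^{\gamma S_j}\bigr)&\text{if }\gamma\ne 0,\\ \sum_{j=1}^dp_{i,j}\,S_j&\text{if }\gamma=0,\end{cases}\qquad p_{i,j}=\frac{a_{i,j}\sigma_j}{A_i\sigma}.$$ As a consequence, $$\mathcal L(AX\mid AX\not\le 0)=\operatorname{GP}_U\bigl(A\sigma,\ (\gamma,\dots,\gamma),\ \mathcal L(U)\bigr),$$ an $m$-variate generalized Pareto distribution, where $(\gamma,\dots,\gamma)\in\mathbb R^m$.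
   Context: Conventions: $X$ and $\sigma$ are $d\times1$ column vectors and $AX$, $A_iX$, $A\sigma$, $A_i\sigma$ are matrix products. In sums with nonnegative coefficients, terms with zero coefficient are omitted: $0\times(\pm\infty)=0$, so e.g. $\sum_ja_jX_j=\sum\{a_jX_j:a_j\ne0\}$. Otherwise operations and order relations between vectors are componentwise; $a\wedge b=\min(a,b)$; $\max(x)$ is the largest component of $x$; $e^{-\infty}=0$, $\log 0=-\infty$, $\log\infty=\infty$; $y\not\le x$ means $y_i>x_i$ for at least one $i$; $\mathcal L$ denotes (conditional) law. If $\gamma=0$, $(1+\gamma x)^{-1/\gamma}$ is read as $e^{-x}$. A function $\ell:[0,\infty)^d\to[0,\infty)$ is a stable tail dependence function (stdf) if there is a random vector $V$ with values in $[0,\infty)^d$ and $\mathbb E[V_j]=1$ for all $j$ such that $\ell(y)=\mathbb E[\max_{j}(y_jV_j)]$ for all $y\in[0,\infty)^d$. For $\sigma\in(0,\infty)^d$, $\gamma\in\mathbb R^d$, $\pi\in(0,1]^d$ and a stdf $\ell$ with $\ell(\pi)=1$, put $\eta_j=-\sigma_j/\gamma_j$ if $\gamma_j>0$ and $\eta_j=-\infty$ if $\gamma_j\le 0$. $\operatorname{GP}(\sigma,\gamma,\pi,\ell)$ is the probability distribution concentrated on $\{x\in[-\infty,\infty)^d:x\ge\eta,\ x_j>0\text{ for some }j\}$ whose cdf $H$ satisfies $H(x)=\ell\{\pi(1+\gamma\tfrac{x\wedge 0}{\sigma})^{-1/\gamma}\}-\ell\{\pi(1+\gamma\tfrac{x}{\sigma})^{-1/\gamma}\}$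 for all $x\in\mathbb R^d$ with $\sigma_j+\gamma_jx_j>0$ for all $j$. A spectral random vector is a random vector $S$ with values in $[-\infty,0]^d$, $\Pr[\max(S)=0]=1$ and $\Pr[S_j>-\infty]>0$ for all $j$. $\operatorname{GP}_S(\sigma,\gamma,\mathcal L(S))$ denotes $\operatorname{GP}(\sigma,\gamma,\pi,\ell)$ with $\pi_j=\mathbb E[e^{S_j}]$ and $\ell(y)=\mathbb E[\max_j(y_je^{S_j}/\pi_j)]$; equivalently, it is the law of $\sigma(e^{\gamma(S+E)}-1)/\gamma$ (componentwise, read as $\sigma_j(S_j+E)$ when $\gamma_j=0$), with $E$ unit exponential independent of $S$. For a random vector $U$ in $[-\infty,\infty)^m$ with $0<\mathbb E[e^{U_i}]<\infty$ for all $i$, $\operatorname{GP}_U(\sigma,\gamma,\mathcal L(U))$ denotes the $m$-variate distribution $\operatorname{GP}(\sigma,\gamma,\pi,\ell)$ with $\pi_i=\mathbb E[e^{U_i}]/\mathbb E[e^{\max(U)}]$ and $\ell(y)=\mathbb E[\max_i\{y_ie^{U_i}/\mathbb E[e^{U_i}]\}]$. *)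

theory Defs
  imports "HOL-Probability.Probability"
begin

text \<open>
  Vectors with entries in \<open>[-\<infinity>,\<infinity>]\<close> have type \<open>ereal ^ 'd\<close>, with the product topology and its
  Borel sigma-algebra; their library order is componentwise. The multiplication of
  \<open>ereal\<close> satisfies \<open>0 * (\<plusminus>\<infinity>) = 0\<close>, so that terms with zero coefficient drop out of sums.
\<close>

definition eexp :: "ereal \<Rightarrow> ereal" where
  "eexp x = (case x of ereal r \<Rightarrow> ereal (exp r) | PInfty \<Rightarrow> \<infinity> | MInfty \<Rightarrow> 0)"

text \<open>The value of \<open>eln\<close> at negative arguments is immaterial.\<close>

definition eln :: "ereal \<Rightarrow> ereal" where
  "eln x = (case x of ereal r \<Rightarrow> if r \<le> 0 then -\<infinity> else ereal (ln r) | PInfty \<Rightarrow> \<infinity> | MInfty \<Rightarrow> -\<infinity>)"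

text \<open>Agrees with \<open>eexp\<close> on \<open>[-\<infinity>,\<infinity>)\<close>; real-valued, for use under the Bochner integral.\<close>

abbreviation rexp :: "ereal \<Rightarrow> real" where
  "rexp x \<equiv> real_of_ereal (eexp x)"

definition evec :: "real ^ 'd \<Rightarrow> ereal ^ 'd" where
  "evec x = (\<chi> j. ereal (x $ j))"

definition emat_vec :: "real ^ 'd ^ 'm \<Rightarrow> ereal ^ 'd \<Rightarrow> ereal ^ 'm" where
  "emat_vec A x = (\<chi> i. \<Sum>j\<in>UNIV. ereal (A $ i $ j) * x $ j)"

text \<open>\<open>(1 + \<gamma> z) powr (- 1 / \<gamma>)\<close>, read as \<open>exp (- z)\<close> if \<open>\<gamma> = 0\<close>; used only where \<open>1 + \<gamma> z > 0\<close>.\<close>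

definition gp_tail :: "real \<Rightarrow> real \<Rightarrow> real" where
  "gp_tail \<gamma> z = (if \<gamma> = 0 then exp (- z) else (1 + \<gamma> * z) powr (- 1 / \<gamma>))"

text \<open>
  \<open>V\<close> below is the law of the random vector generating the stdf. Only the values of \<open>l\<close> on the
  nonnegative orthant matter.
\<close>

definition stdf :: "(real ^ 'd \<Rightarrow> real) \<Rightarrow> bool" where
  "stdf l \<longleftrightarrow> (\<exists>V :: (real ^ 'd) measure. prob_space V \<and> sets V = sets borel \<and>
     (AE v in V. \<forall>j. 0 \<le> v $ j) \<and>
     (\<forall>j. integrable V (\<lambda>v. v $ j) \<and> (\<integral>v. v $ j \<partial>V) = 1) \<and>
     (\<forall>y. (\<forall>j. 0 \<le> y $ j) \<longrightarrow> l y = (\<integral>v. (MAX j. y $ j * v $ j) \<partial>V)))"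

definition gp_eta :: "real ^ 'd \<Rightarrow> real ^ 'd \<Rightarrow> ereal ^ 'd" where
  "gp_eta \<sigma> \<gamma> = (\<chi> j. if \<gamma> $ j > 0 then ereal (- \<sigma> $ j / \<gamma> $ j) else -\<infinity>)"

text \<open>\<open>is_GP \<sigma> \<gamma> \<pi> l D\<close>: the parameters are admissible and \<open>D\<close> is the distribution \<open>GP(\<sigma>, \<gamma>, \<pi>, l)\<close>.\<close>

definition is_GP ::
  "real ^ 'd \<Rightarrow> real ^ 'd \<Rightarrow> real ^ 'd \<Rightarrow> (real ^ 'd \<Rightarrow> real) \<Rightarrow> (ereal ^ 'd) measure \<Rightarrow> bool" where
  "is_GP \<sigma> \<gamma> \<pi> l D \<longleftrightarrow>
     (\<forall>j. 0 < \<sigma> $ j) \<and> (\<forall>j. 0 < \<pi> $ j \<and> \<pi> $ j \<le> 1) \<and> stdf l \<and> l \<pi> = 1 \<and>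
     prob_space D \<and> sets D = sets borel \<and>
     (AE x in D. (\<forall>j. x $ j < \<infinity>) \<and> gp_eta \<sigma> \<gamma> \<le> x \<and> (\<exists>j. 0 < x $ j)) \<and>
     (\<forall>x :: real ^ 'd. (\<forall>j. 0 < \<sigma> $ j + \<gamma> $ j * x $ j) \<longrightarrow>
        measure D {z. z \<le> evec x} =
          l (\<chi> j. \<pi> $ j * gp_tail (\<gamma> $ j) (min (x $ j) 0 / \<sigma> $ j))
        - l (\<chi> j. \<pi> $ j * gp_tail (\<gamma> $ j) (x $ j / \<sigma> $ j)))"

definition spectral_random_vector :: "'a measure \<Rightarrow> ('a \<Rightarrow> ereal ^ 'd) \<Rightarrow> bool" where
  "spectral_random_vector N S \<longleftrightarrow>
     prob_space N \<and> S \<in> borel_measurable N \<and>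
     (\<forall>\<omega>\<in>space N. \<forall>j. S \<omega> $ j \<le> 0) \<and>
     measure N {\<omega> \<in> space N. (MAX j. S \<omega> $ j) = 0} = 1 \<and>
     (\<forall>j. measure N {\<omega> \<in> space N. S \<omega> $ j > -\<infinity>} > 0)"

text \<open>
  \<open>is_GP_S \<sigma> \<gamma> N S D\<close>: \<open>D\<close> is the distribution \<open>GP\<^sub>S(\<sigma>, \<gamma>, L(S))\<close>, with \<open>S\<close> defined on the
  probability space \<open>N\<close>; similarly for \<open>is_GP_U\<close>.
\<close>

definition is_GP_S ::
  "real ^ 'd \<Rightarrow> real ^ 'd \<Rightarrow> 'a measure \<Rightarrow> ('a \<Rightarrow> ereal ^ 'd) \<Rightarrow> (ereal ^ 'd) measure \<Rightarrow> bool" where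
  "is_GP_S \<sigma> \<gamma> N S D \<longleftrightarrow>
     spectral_random_vector N S \<and>
     (let \<pi> = (\<chi> j. \<integral>\<omega>. rexp (S \<omega> $ j) \<partial>N);
          l = (\<lambda>y. \<integral>\<omega>. (MAX j. y $ j * rexp (S \<omega> $ j) / \<pi> $ j) \<partial>N)
      in is_GP \<sigma> \<gamma> \<pi> l D)"

definition exp_integrable_vector :: "'a measure \<Rightarrow> ('a \<Rightarrow> ereal ^ 'm) \<Rightarrow> bool" where
  "exp_integrable_vector N U \<longleftrightarrow>
     prob_space N \<and> U \<in> borel_measurable N \<and>
     (\<forall>\<omega>\<in>space N. \<forall>i. U \<omega> $ i < \<infinity>) \<and>
     (\<forall>i. integrable N (\<lambda>\<omega>. rexp (U \<omega> $ i)) \<and> 0 < (\<integral>\<omega>. rexp (U \<omega> $ i) \<partial>N))"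

definition is_GP_U ::
  "real ^ 'm \<Rightarrow> real ^ 'm \<Rightarrow> 'a measure \<Rightarrow> ('a \<Rightarrow> ereal ^ 'm) \<Rightarrow> (ereal ^ 'm) measure \<Rightarrow> bool" where
  "is_GP_U \<sigma> \<gamma> N U D \<longleftrightarrow>
     exp_integrable_vector N U \<and>
     (let e = (\<lambda>i. \<integral>\<omega>. rexp (U \<omega> $ i) \<partial>N);
          \<pi> = (\<chi> i. e i / (\<integral>\<omega>. rexp (MAX k. U \<omega> $ k) \<partial>N));
          l = (\<lambda>y. \<integral>\<omega>. (MAX i. y $ i * rexp (U \<omega> $ i) / e i) \<partial>N)
      in is_GP \<sigma> \<gamma> \<pi> l D)"

text \<open>The vector \<open>U\<close> as a function of \<open>S\<close>; \<open>p i j\<close> are the normalised weights of row \<open>i\<close>.\<close>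

definition gp_weight :: "real ^ 'd ^ 'm \<Rightarrow> real ^ 'd \<Rightarrow> 'm \<Rightarrow> 'd \<Rightarrow> real" where
  "gp_weight A \<sigma> i j = A $ i $ j * \<sigma> $ j / (A *v \<sigma>) $ i"

definition gp_U :: "real ^ 'd ^ 'm \<Rightarrow> real ^ 'd \<Rightarrow> real \<Rightarrow> ereal ^ 'd \<Rightarrow> ereal ^ 'm" where
  "gp_U A \<sigma> \<gamma> s = (\<chi> i.
     if \<gamma> \<noteq> 0
     then ereal (1 / \<gamma>) * eln (\<Sum>j\<in>UNIV. ereal (gp_weight A \<sigma> i j) * eexp (ereal \<gamma> * s $ j))
     else (\<Sum>j\<in>UNIV. ereal (gp_weight A \<sigma> i j) * s $ j))"

end

theory Submission
  imports Defs
begin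

text \<open>
  On the exponential scale everything becomes \<open>S + E\<close>, with \<open>E\<close> unit exponential and independent
  of \<open>S\<close>. The coordinatewise change of scale \<open>\<psi>(y) = \<sigma> (exp (\<gamma> y) - 1) / \<gamma>\<close> sends \<open>S + E\<close> to a vector
  with the law of \<open>X\<close>, because the cdf prescribed by \<open>GP\<^sub>S\<close> is, on that scale,
  \<open>1 - E[min 1 (max\<^sub>j exp (S\<^sub>j - y\<^sub>j))] = P(S + E \<le> y)\<close>. As the shape \<open>\<gamma>\<close> is common to all coordinates, a
  nonnegative combination of the \<open>\<psi>(S\<^sub>j + E)\<close> is again of the form \<open>\<psi>(U\<^sub>i + E)\<close> with scale \<open>A\<^sub>i \<sigma>\<close>, and
  conditioning on \<open>S\<close> gives the tail formula. For the conditional law one uses that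
  \<open>E[min 1 K] - E[min 1 L] = E[K] - E[L]\<close>, where \<open>K\<close> and \<open>L\<close> are the maxima at the points \<open>min x 0\<close> and \<open>x\<close>.
\<close>

section \<open>Borel measures on extended real vectors\<close>

text \<open>An open set of the product topology is a union of open boxes, and by second countability
  boxes with sides in one countable basis suffice. The union is then countable, and membership in a
  box is a finite conjunction of conditions on coordinates.\<close>

lemma borel_measurable_vecI:
  fixes f :: "'a \<Rightarrow> 'b::second_countable_topology ^ 'n"
  assumes "\<And>i. (\<lambda>x. f x $ i) \<in> borel_measurable M"
  shows "f \<in> borel_measurable M"
proof (rule borel_measurableI)
  fix W :: "('b ^ 'n) set" assume "open W"
  obtain B :: "'b set set" where B: "countable B" "topological_basis B"
    using ex_countable_basis by blast
  define box where "box F = {y :: 'b ^ 'n. \<forall>i. y $ i \<in> F i}" for F :: "'n \<Rightarrow> 'b set"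
  define C where "C = {F \<in> PiE UNIV (\<lambda>_. B). box F \<subseteq> W}"
  have "countable (PiE (UNIV :: 'n set) (\<lambda>_. B))"
    using B by (intro countable_PiE) auto
  then have C: "countable C"
    unfolding C_def by (rule countable_subset[rotated]) auto
  have W: "W = (\<Union>F\<in>C. box F)"
  proof (intro equalityI subsetI)
    fix x assume "x \<in> W"
    then obtain G where G: "\<And>i. open (G i)" "\<And>i. x $ i \<in> G i" "\<And>y. (\<forall>i. y $ i \<in> G i) \<Longrightarrow> y \<in> W"
      using \<open>open W\<close> unfolding open_vec_def by metis
    then have "\<forall>i. \<exists>b\<in>B. x $ i \<in> b \<and> b \<subseteq> G i"
      using topological_basisE[OF B(2)] by metis
    then obtain F where F: "\<And>i. F i \<in> B" "\<And>i. x $ i \<in> F i" "\<And>i. F i \<subseteq> G i"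
      by metis
    then have "F \<in> C"
      unfolding C_def box_def using G(3) by blast
    then show "x \<in> (\<Union>F\<in>C. box F)"
      using F(2) unfolding box_def by blast
  qed (auto simp: C_def)
  have "{x \<in> space M. f x \<in> box F} \<in> sets M" if "F \<in> C" for F
  proof -
    have "open (F i)" for i
      using that B(2) unfolding C_def PiE_def Pi_def by (auto intro: topological_basis_open)
    then have [measurable]: "F i \<in> sets borel" for i
      by simp
    note assms[measurable]
    show ?thesis
      unfolding box_def mem_Collect_eq by measurable
  qed
  then have "(\<Union>F\<in>C. {x \<in> space M. f x \<in> box F}) \<in> sets M"
    using C by (intro sets.countable_UN') auto
  also have "(\<Union>F\<in>C. {x \<in> space M. f x \<in> box F}) = f -` W \<inter> space M"
    unfolding W by auto
  finally show "f -` W \<inter> space M \<in> sets M" .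
qed

lemma borel_measurable_vec_nth [measurable]:
  "(\<lambda>x :: 'b::topological_space ^ 'n. x $ i) \<in> borel_measurable borel"
  by (intro borel_measurable_continuous_onI continuous_intros)

lemma vec_le_sets_borel:
  fixes f g :: "'a \<Rightarrow> ereal ^ 'n"
  assumes [measurable]: "f \<in> borel_measurable M" "g \<in> borel_measurable M"
  shows "{x \<in> space M. f x \<le> g x} \<in> sets M"
  unfolding less_eq_vec_def by measurable

text \<open>Since corners may have infinite coordinates, a half-space \<open>z $ i \<le> a\<close>
  is itself an orthant, with \<open>\<infinity>\<close> in all other places of the corner.
  Half-spaces already decide measurability of the coordinates.\<close>

lemma sets_borel_ereal_vec:
  "sets (borel :: (ereal ^ 'n) measure) = sigma_sets UNIV (range (\<lambda>c. {z. z \<le> c}))"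
proof (rule antisym)
  let ?E = "range (\<lambda>c. {z :: ereal ^ 'n. z \<le> c})"
  have "{z :: ereal ^ 'n. z \<le> c} \<in> sets borel" for c
    using vec_le_sets_borel[of "\<lambda>z. z" borel "\<lambda>_. c"] by simp
  then show "sigma_sets UNIV ?E \<subseteq> sets borel"
    using sets.sigma_sets_subset[of ?E borel] by auto
  have "(\<lambda>z. z) \<in> borel_measurable (sigma UNIV ?E)"
  proof (intro borel_measurable_vecI borel_measurableI_le)
    fix i and a :: ereal
    have "{z :: ereal ^ 'n. z $ i \<le> a} = {z. z \<le> (\<chi> j. if j = i then a else \<infinity>)}"
      by (auto simp: less_eq_vec_def)
    then have "{z. z $ i \<le> a} \<in> ?E"
      by blast
    then show "{x \<in> space (sigma UNIV ?E). x $ i \<le> a} \<in> sets (sigma UNIV ?E)"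
      by (simp add: space_measure_of_conv sigma_sets.Basic)
  qed
  then show "sets borel \<subseteq> sigma_sets UNIV ?E"
    by (auto dest!: measurable_sets simp: space_measure_of_conv)
qed

text \<open>A generalized Pareto law prescribes its cdf at real points only, whereas the orthants of
  \<open>sets_borel_ereal_vec\<close> have extended corners; this lemma bridges the gap. How mass is
  spread over points with a coordinate \<open>\<infinity>\<close> cannot be seen from real corners,
  hence \<open>fin\<close>.\<close>

lemma measure_eqI_ereal_vec_cdf:
  fixes D K :: "(ereal ^ 'n) measure"
  assumes D: "prob_space D" "sets D = sets borel" and K: "prob_space K" "sets K = sets borel"
    and fin: "AE z in K. \<forall>j. z $ j < \<infinity>"
    and eq: "\<And>x. measure D {z. z \<le> evec x} = measure K {z. z \<le> evec x}"
  shows "D = K"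
proof -
  interpret D: prob_space D by fact
  interpret K: prob_space K by fact
  note [measurable_cong] = D(2) K(2)
  have [measurable]: "{z :: ereal ^ 'n. z \<le> c} \<in> sets borel" for c
    unfolding sets_borel_ereal_vec by (rule sigma_sets.Basic) blast
  have spD: "space D = UNIV" and spK: "space K = UNIV"
    using D(2) K(2) by (auto dest: sets_eq_imp_space_eq)
  text \<open>
    The truncation of \<open>c\<close> at \<open>\<plusminus>n\<close> is real, and for \<open>z < \<infinity>\<close> it eventually compares with \<open>z\<close> as \<open>c\<close> does.
    Hence the values of the cdf at real points determine it everywhere.
  \<close>
  define tr :: "ereal ^ 'n \<Rightarrow> nat \<Rightarrow> real ^ 'n" where
    "tr c n = (\<chi> j. real_of_ereal (max (ereal (- real n)) (min (c $ j) (ereal (real n)))))" for c n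
  have ev1: "\<forall>\<^sub>F n in sequentially. (a \<le> ereal (real_of_ereal (max (ereal (- real n)) (min b (ereal (real n)))))) = (a \<le> b)"
    if "a < \<infinity>" for a b :: ereal
  proof (cases b)
    case (real r)
    then have "\<forall>\<^sub>F n in sequentially. \<bar>r\<bar> \<le> real n"
      by real_asymp
    then show ?thesis
      by eventually_elim (auto simp: real max_def min_def)
  next
    case PInf
    show ?thesis
    proof (cases a)
      case (real r)
      then have "\<forall>\<^sub>F n in sequentially. \<bar>r\<bar> \<le> real n"
        by real_asymp
      then show ?thesis
        by eventually_elim (auto simp: real PInf max_def min_def)
    qed (use that in auto)
  next
    case MInf
    show ?thesis
    proof (cases a)
      case (real r)
      \<comment> \<open>Strict, unlike the other cases: the truncation of
        \<open>-\<infinity>\<close> is \<open>-n\<close>, and \<open>r \<le> -n\<close> has to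
        fail.\<close>
      then have "\<forall>\<^sub>F n in sequentially. \<bar>r\<bar> < real n"
        by real_asymp
      then show ?thesis
        by eventually_elim (auto simp: real MInf max_def min_def)
    qed (use that MInf in auto)
  qed
  have ev: "\<forall>\<^sub>F n in sequentially. (z \<le> evec (tr c n)) = (z \<le> c)" if "\<forall>j. z $ j < \<infinity>" for z c
  proof -
    have "\<forall>\<^sub>F n in sequentially. \<forall>j\<in>UNIV. (z $ j \<le> evec (tr c n) $ j) = (z $ j \<le> c $ j)"
      using ev1 that by (intro eventually_ball_finite) (auto simp: evec_def tr_def)
    then show ?thesis
      by eventually_elim (auto simp: less_eq_vec_def)
  qed
  have lim: "(\<lambda>n. measure Q {z. z \<le> evec (tr c n)}) \<longlonglongrightarrow> measure Q {z. z \<le> c}"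
    if "prob_space Q" "sets Q = sets borel" "AE z in Q. \<forall>j. z $ j < \<infinity>" for Q c
  proof -
    interpret prob_space Q by fact
    note [measurable_cong] = that(2)
    have sp: "space Q = UNIV" using that(2) by (auto dest: sets_eq_imp_space_eq)
    have "(\<lambda>n. \<integral>z. indicat_real {z. z \<le> evec (tr c n)} z \<partial>Q) \<longlonglongrightarrow> (\<integral>z. indicat_real {z. z \<le> c} z \<partial>Q)"
    proof (rule integral_dominated_convergence[where w = "\<lambda>_. 1"])
      show "AE z in Q. (\<lambda>n. indicat_real {z. z \<le> evec (tr c n)} z) \<longlonglongrightarrow> indicat_real {z. z \<le> c} z"
        using that(3)
      proof eventually_elim
        case (elim z)
        show ?case
          by (rule tendsto_eventually, rule eventually_mono[OF ev[OF elim, of c]]) (simp add: indicator_def)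
      qed
    next
      show "indicat_real {z. z \<le> c} \<in> borel_measurable Q"
        "indicat_real {z. z \<le> evec (tr c n)} \<in> borel_measurable Q" for n
        by measurable
    qed (auto simp: indicator_def)
    then show ?thesis by (simp add: sp)
  qed
  \<comment> \<open>Finiteness passes from \<open>K\<close> to \<open>D\<close>: truncating the
    corner with all coordinates \<open>\<infinity>\<close> gives the point with all coordinates
    \<open>n\<close>, and there the cdf of \<open>K\<close>, hence that of \<open>D\<close>, tends
    to 1.\<close>
  have finD: "AE z in D. \<forall>j. z $ j < \<infinity>"
  proof -
    have "(\<lambda>n. measure K {z. z \<le> evec (tr (\<chi> j. \<infinity>) n)}) \<longlonglongrightarrow> measure K {z. z \<le> (\<chi> j. \<infinity>)}"
      by (rule lim) (use K fin in auto)
    moreover have "{z :: ereal ^ 'n. z \<le> (\<chi> j. \<infinity>)} = space K"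
      by (auto simp: less_eq_vec_def spK)
    ultimately have *: "(\<lambda>n. measure D {z. z \<le> evec (tr (\<chi> j. \<infinity>) n)}) \<longlonglongrightarrow> 1"
      by (simp add: eq K.prob_space)
    have m: "{z :: ereal ^ 'n. \<forall>j. z $ j < \<infinity>} \<in> sets D"
    proof -
      have "{z \<in> space D. \<forall>j. z $ j < \<infinity>} \<in> sets D" by measurable
      then show ?thesis by (simp add: spD)
    qed
    have "{z :: ereal ^ 'n. z \<le> evec x} \<subseteq> {z. \<forall>j. z $ j < \<infinity>}" for x
    proof (intro subsetI CollectI allI)
      fix z j assume "z \<in> {z :: ereal ^ 'n. z \<le> evec x}"
      then have "z $ j \<le> ereal (x $ j)"
        by (simp add: less_eq_vec_def evec_def)
      then show "z $ j < \<infinity>"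
        by (rule le_less_trans) simp
    qed
    then have "measure D {z. z \<le> evec (tr (\<chi> j. \<infinity>) n)} \<le> measure D {z. \<forall>j. z $ j < \<infinity>}" for n
      using m by (intro D.finite_measure_mono)
    then have "1 \<le> measure D {z. \<forall>j. z $ j < \<infinity>}"
      using * by (intro LIMSEQ_le_const2[OF *]) auto
    then have "measure D {z. \<forall>j. z $ j < \<infinity>} = 1"
      using D.prob_le_1 by (intro antisym)
    then show ?thesis
      using D.prob_eq_1[OF m] by simp
  qed
  have *: "measure D {z. z \<le> c} = measure K {z. z \<le> c}" for c
    using LIMSEQ_unique[OF lim[OF D finD, of c]] lim[OF K fin, of c] by (simp add: eq)
  show ?thesis
  proof (rule measure_eqI_generator_eq[where E = "range (\<lambda>c. {z. z \<le> c})" and \<Omega> = UNIV and A = "\<lambda>_. UNIV"])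
    show "Int_stable (range (\<lambda>c :: ereal ^ 'n. {z. z \<le> c}))"
    proof (intro Int_stableI_image)
      fix a b :: "ereal ^ 'n"
      have "{z. z \<le> a} \<inter> {z. z \<le> b} = {z. z \<le> (\<chi> j. min (a $ j) (b $ j))}"
        by (auto simp: less_eq_vec_def)
      then show "\<exists>c\<in>UNIV. {z. z \<le> a} \<inter> {z. z \<le> b} = {z. z \<le> c}" by blast
    qed
    have "(UNIV :: (ereal ^ 'n) set) = {z. z \<le> (\<chi> j. \<infinity>)}"
      by (auto simp: less_eq_vec_def)
    then show "range (\<lambda>_ :: nat. UNIV :: (ereal ^ 'n) set) \<subseteq> range (\<lambda>c. {z. z \<le> c})"
      by blast
    show "emeasure D X = emeasure K X" if "X \<in> range (\<lambda>c. {z. z \<le> c})" for X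
      using that * by (auto simp: D.emeasure_eq_measure K.emeasure_eq_measure)
  qed (use D K in \<open>auto simp: sets_borel_ereal_vec\<close>)
qed

section \<open>The exponential scale\<close>

lemma eexp_simps [simp]:
  "eexp (ereal r) = ereal (exp r)" "eexp \<infinity> = \<infinity>" "eexp (-\<infinity>) = 0" "eexp 0 = 1"
  by (simp_all add: eexp_def zero_ereal_def one_ereal_def)

lemma eln_simps [simp]:
  "eln (ereal r) = (if r \<le> 0 then -\<infinity> else ereal (ln r))" "eln \<infinity> = \<infinity>" "eln (-\<infinity>) = -\<infinity>"
  by (simp_all add: eln_def)

lemma eexp_nonneg [simp]: "0 \<le> eexp x"
  by (cases x) auto

lemma rexp_nonneg [simp]: "0 \<le> rexp x"
  by (simp add: real_of_ereal_pos)

lemma rexp_le_1: "x \<le> 0 \<Longrightarrow> rexp x \<le> 1"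
  by (cases x) auto

lemma measurable_eexp [measurable]: "eexp \<in> borel_measurable borel"
proof -
  have "eexp = (\<lambda>x. if x = \<infinity> then \<infinity> else if x = -\<infinity> then 0 else ereal (exp (real_of_ereal x)))"
    by (rule ext) (metis eexp_simps ereal_cases real_of_ereal.simps(1) PInfty_neq_ereal(2) MInfty_neq_ereal(2))
  moreover have "\<dots> \<in> borel_measurable borel" by measurable
  ultimately show ?thesis by simp
qed

lemma measurable_eln [measurable]: "eln \<in> borel_measurable borel"
proof -
  have "eln = (\<lambda>x. if x = \<infinity> then \<infinity> else if x \<le> 0 then -\<infinity> else ereal (ln (real_of_ereal x)))"
  proof
    fix x show "eln x = (if x = \<infinity> then \<infinity> else if x \<le> 0 then -\<infinity> else ereal (ln (real_of_ereal x)))"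
      by (cases x) auto
  qed
  moreover have "\<dots> \<in> borel_measurable borel" by measurable
  ultimately show ?thesis by simp
qed

text \<open>
  The map \<open>\<psi>\<close> above on extended reals, its inverse, and its restriction to the reals. The inverse is
  only applied to values in the support of a generalized Pareto law; outside of it, the junk value
  \<open>eln x = -\<infinity>\<close> for \<open>x < 0\<close> makes \<open>exp_of_gp\<close> equal to \<open>-\<infinity>\<close> below and \<open>\<infinity>\<close> above the support, so that
  \<open>exp_of_gp_le_iff\<close> below holds without restriction.
\<close>

definition gp_of_exp :: "real \<Rightarrow> real \<Rightarrow> ereal \<Rightarrow> ereal" where
  "gp_of_exp \<sigma> \<gamma> y =
     (if \<gamma> = 0 then ereal \<sigma> * y else ereal (\<sigma> / \<gamma>) * (eexp (ereal \<gamma> * y) - 1))"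

definition exp_of_gp :: "real \<Rightarrow> real \<Rightarrow> ereal \<Rightarrow> ereal" where
  "exp_of_gp \<sigma> \<gamma> z =
     (if \<gamma> = 0 then ereal (1 / \<sigma>) * z else ereal (1 / \<gamma>) * eln (1 + ereal (\<gamma> / \<sigma>) * z))"

definition gp_point :: "real \<Rightarrow> real \<Rightarrow> real \<Rightarrow> real" where
  "gp_point \<sigma> \<gamma> t = (if \<gamma> = 0 then \<sigma> * t else \<sigma> / \<gamma> * (exp (\<gamma> * t) - 1))"

lemma measurable_gp_of_exp [measurable]: "gp_of_exp \<sigma> \<gamma> \<in> borel_measurable borel"
  unfolding gp_of_exp_def by measurable

lemma measurable_exp_of_gp [measurable]: "exp_of_gp \<sigma> \<gamma> \<in> borel_measurable borel"
  unfolding exp_of_gp_def by measurable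

lemma gp_of_exp_ereal: "gp_of_exp \<sigma> \<gamma> (ereal t) = ereal (gp_point \<sigma> \<gamma> t)"
  by (simp add: gp_of_exp_def gp_point_def one_ereal_def)

lemma gp_point_admissible: "0 < \<sigma> \<Longrightarrow> 0 < \<sigma> + \<gamma> * gp_point \<sigma> \<gamma> t"
  by (simp add: gp_point_def field_simps)

lemma gp_point_surj:
  assumes "0 < \<sigma>" "0 < \<sigma> + \<gamma> * x"
  obtains t where "x = gp_point \<sigma> \<gamma> t"
proof (cases "\<gamma> = 0")
  case True
  then show ?thesis using assms that[of "x / \<sigma>"] by (simp add: gp_point_def)
next
  case False
  have "0 < 1 + \<gamma> * x / \<sigma>"
    using assms by (simp add: field_simps)
  then have "gp_point \<sigma> \<gamma> (ln (1 + \<gamma> * x / \<sigma>) / \<gamma>) = x"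
    using False assms by (simp add: gp_point_def)
  then show ?thesis using that by metis
qed

lemma gp_tail_gp_point: "0 < \<sigma> \<Longrightarrow> gp_tail \<gamma> (gp_point \<sigma> \<gamma> t / \<sigma>) = exp (- t)"
  by (auto simp: gp_tail_def gp_point_def powr_def)

lemma gp_point_0 [simp]: "gp_point \<sigma> \<gamma> 0 = 0"
  by (simp add: gp_point_def)

lemma strict_mono_gp_point: "0 < \<sigma> \<Longrightarrow> strict_mono (gp_point \<sigma> \<gamma>)"
proof (rule strict_monoI)
  fix s t :: real assume "0 < \<sigma>" "s < t"
  consider "\<gamma> = 0" | "\<gamma> > 0" | "\<gamma> < 0" by linarith
  then show "gp_point \<sigma> \<gamma> s < gp_point \<sigma> \<gamma> t"
  proof cases
    case 3
    then have "\<gamma> * t < \<gamma> * s" using \<open>s < t\<close> by simp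
    then show ?thesis using 3 \<open>0 < \<sigma>\<close> by (simp add: gp_point_def divide_simps)
  qed (use \<open>0 < \<sigma>\<close> \<open>s < t\<close> in \<open>simp_all add: gp_point_def divide_simps\<close>)
qed

lemma gp_point_min:
  assumes "0 < \<sigma>"
  shows "min (gp_point \<sigma> \<gamma> t) 0 = gp_point \<sigma> \<gamma> (min t 0)"
  using strict_mono_less_eq[OF strict_mono_gp_point[OF assms, of \<gamma>], of t 0]
  by (auto simp: min_def)

lemma gp_of_exp_le_gp_point_iff:
  assumes "0 < \<sigma>"
  shows "gp_of_exp \<sigma> \<gamma> y \<le> ereal (gp_point \<sigma> \<gamma> t) \<longleftrightarrow> y \<le> ereal t"
proof -
  \<comment> \<open>For infinite \<open>y\<close>: at \<open>-\<infinity>\<close> with \<gamma> > 0,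
    and at \<open>\<infinity>\<close> with \<gamma> < 0, the value of \<open>gp_of_exp\<close> is
    the finite endpoint \<open>- \<sigma> / \<gamma>\<close>, which no \<open>gp_point\<close>
    reaches.\<close>
  have low: "- \<sigma> < \<sigma> * (exp (\<gamma> * t) - 1)"
    using assms by (simp add: right_diff_distrib)
  show ?thesis
  proof (cases y)
    case (real r)
    then show ?thesis
      using strict_mono_less_eq[OF strict_mono_gp_point[OF assms, of \<gamma>], of r t]
      by (simp add: gp_of_exp_ereal)
  qed (use assms low in \<open>auto simp: gp_of_exp_def gp_point_def one_ereal_def divide_simps zero_ereal_def\<close>)
qed

lemma exp_of_gp_le_iff:
  assumes "0 < \<sigma>"
  shows "exp_of_gp \<sigma> \<gamma> z \<le> ereal t \<longleftrightarrow> z \<le> ereal (gp_point \<sigma> \<gamma> t)"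
proof -
  have ln_le: "ln a \<le> b \<longleftrightarrow> a \<le> exp b" "b \<le> ln a \<longleftrightarrow> exp b \<le> a" if "0 < a" for a b :: real
    using that by (metis exp_le_cancel_iff exp_ln)+
  \<comment> \<open>Here \<open>r\<close> lies at or beyond the endpoint
    \<open>- \<sigma> / \<gamma>\<close>, where \<open>eln\<close> is \<open>-\<infinity>\<close>.
    Dividing by \<gamma> puts \<open>r\<close> below every \<open>gp_point\<close> if \<gamma> > 0
    and above every one if \<gamma> < 0.\<close>
  have below: "\<sigma> + \<gamma> * r < \<sigma> * exp (\<gamma> * t)" if "1 + \<gamma> / \<sigma> * r \<le> 0" for r
  proof -
    have "\<sigma> + \<gamma> * r = \<sigma> * (1 + \<gamma> / \<sigma> * r)"
      using assms by (simp add: field_simps)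
    also have "\<dots> \<le> 0"
      using assms that by (intro mult_nonneg_nonpos) auto
    also have "\<dots> < \<sigma> * exp (\<gamma> * t)"
      using assms by simp
    finally show ?thesis .
  qed
  consider "\<gamma> = 0" | "\<gamma> > 0" | "\<gamma> < 0" by linarith
  then show ?thesis
  proof cases
    case 1
    then show ?thesis
      using assms by (cases z) (auto simp: exp_of_gp_def gp_point_def field_simps)
  next
    case 2
    have *: "0 < exp (t * \<gamma>)" by simp
    show ?thesis
    proof (cases z)
      case (real r)
      show ?thesis
      proof (cases "1 + \<gamma> / \<sigma> * r \<le> 0")
        case True
        then have "\<sigma> + \<gamma> * r < \<sigma> * exp (\<gamma> * t)"
          by (rule below)
        then have "r \<le> \<sigma> / \<gamma> * (exp (\<gamma> * t) - 1)"
          using 2 by (simp add: field_simps)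
        then show ?thesis
          using True 2 by (simp add: exp_of_gp_def gp_point_def real one_ereal_def)
      next
        case False
        then have "exp_of_gp \<sigma> \<gamma> z \<le> ereal t \<longleftrightarrow> ln (1 + \<gamma> / \<sigma> * r) \<le> \<gamma> * t"
          using 2 by (simp add: exp_of_gp_def real one_ereal_def field_simps)
        also have "\<dots> \<longleftrightarrow> 1 + \<gamma> / \<sigma> * r \<le> exp (\<gamma> * t)"
          using False by (intro ln_le) simp
        finally show ?thesis
          using 2 assms by (simp add: real gp_point_def field_simps)
      qed
    qed (use 2 assms in \<open>auto simp: exp_of_gp_def one_ereal_def\<close>)
  next
    case 3
    show ?thesis
    proof (cases z)
      case (real r)
      show ?thesis
      proof (cases "1 + \<gamma> / \<sigma> * r \<le> 0")
        case True
        then have "\<sigma> + \<gamma> * r < \<sigma> * exp (\<gamma> * t)"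
          by (rule below)
        then have "\<not> r \<le> \<sigma> / \<gamma> * (exp (\<gamma> * t) - 1)"
          using 3 by (simp add: field_simps)
        then show ?thesis
          using True 3 by (simp add: exp_of_gp_def gp_point_def real one_ereal_def)
      next
        case False
        then have "exp_of_gp \<sigma> \<gamma> z \<le> ereal t \<longleftrightarrow> \<gamma> * t \<le> ln (1 + \<gamma> / \<sigma> * r)"
          using 3 by (simp add: exp_of_gp_def real one_ereal_def field_simps)
        also have "\<dots> \<longleftrightarrow> exp (\<gamma> * t) \<le> 1 + \<gamma> / \<sigma> * r"
          using False by (intro ln_le) simp
        finally show ?thesis
          using 3 assms by (simp add: real gp_point_def field_simps)
      qed
    qed (use 3 assms in \<open>auto simp: exp_of_gp_def one_ereal_def divide_simps\<close>)
  qed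
qed

text \<open>The hypotheses keep \<open>z\<close> where \<open>exp_of_gp\<close> loses no
  information. The lower bound is the one in the support condition of a generalized Pareto law. That
  condition states no finite upper endpoint for \<gamma> < 0; it enters instead as finiteness on the
  exponential scale, which holds almost surely because \<open>S + E\<close> is finite from
  above.\<close>

lemma gp_of_exp_exp_of_gp:
  assumes "0 < \<sigma>" and "0 < \<gamma> \<Longrightarrow> ereal (- \<sigma> / \<gamma>) \<le> z" and "exp_of_gp \<sigma> \<gamma> z < \<infinity>"
  shows "gp_of_exp \<sigma> \<gamma> (exp_of_gp \<sigma> \<gamma> z) = z"
proof (cases "\<gamma> = 0")
  case True
  then show ?thesis
    using assms by (cases z) (auto simp: exp_of_gp_def gp_of_exp_def)
next
  case False
  show ?thesis
  proof (cases z)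
    case (real r)
    show ?thesis
    proof (cases "1 + \<gamma> / \<sigma> * r \<le> 0")
      case True
      have "\<gamma> > 0"
      proof (rule ccontr)
        assume "\<not> \<gamma> > 0"
        then have "exp_of_gp \<sigma> \<gamma> z = \<infinity>"
          using True False by (simp add: exp_of_gp_def real one_ereal_def)
        then show False using assms by simp
      qed
      then have "r = - \<sigma> / \<gamma>"
        using assms(1) assms(2)[OF \<open>\<gamma> > 0\<close>] True by (simp add: real field_simps)
      then show ?thesis
        using \<open>\<gamma> > 0\<close> True by (simp add: exp_of_gp_def gp_of_exp_def real one_ereal_def zero_ereal_def)
    next
      case F: False
      then show ?thesis
        using False assms(1) by (simp add: exp_of_gp_def gp_of_exp_def real one_ereal_def)
    qed
  next
    case PInf
    then show ?thesis
      using assms False by (cases "\<gamma> > 0") (auto simp: exp_of_gp_def one_ereal_def divide_simps)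
  next
    case MInf
    then show ?thesis
      using assms False by (cases "\<gamma> > 0") (auto simp: exp_of_gp_def gp_of_exp_def one_ereal_def divide_simps)
  qed
qed

section \<open>Linear combinations\<close>

text \<open>In \<open>ereal\<close> the sum of \<open>\<infinity>\<close> and
  \<open>-\<infinity>\<close> is \<open>\<infinity>\<close>, so a term \<open>-\<infinity>\<close>
  wins only if no term is \<open>\<infinity>\<close>.\<close>

lemma sum_ereal_eq_MInfty:
  fixes f :: "'i \<Rightarrow> ereal"
  assumes "finite I" "\<And>i. i \<in> I \<Longrightarrow> f i < \<infinity>" "k \<in> I" "f k = -\<infinity>"
  shows "sum f I = -\<infinity>"
proof -
  have "sum f (I - {k}) \<noteq> \<infinity>"
    using assms(1,2) by (auto simp: sum_Pinfty)
  then show ?thesis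
    using assms(1,3,4) by (simp add: sum.remove[of I k])
qed

lemma gp_of_exp_less_PInfty: "0 < \<sigma> \<Longrightarrow> y < \<infinity> \<Longrightarrow> gp_of_exp \<sigma> \<gamma> y < \<infinity>"
  by (cases y; cases "\<gamma> > 0") (auto simp: gp_of_exp_def one_ereal_def divide_simps zero_ereal_def)

text \<open>For \<gamma> nonzero and finite terms, each summand is \<open>a j * \<sigma> j /
  \<gamma> * (exp (\<gamma> * s j) * exp (\<gamma> * e) - 1)\<close>. The factor
  \<open>exp (\<gamma> * e)\<close> is common to all of them, so the sum is
  \<open>c / \<gamma>\<close> times the same expression with the weighted mean of the
  \<open>exp (\<gamma> * s j)\<close>, and \<open>U\<close> is the logarithm of that mean divided by
  \<gamma>. For \<gamma> = 0 the weights sum to 1, which takes care of the shift. An entry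
  \<open>-\<infinity>\<close> of positive weight with \<gamma> at most 0 is treated first: both
  sides are then \<open>-\<infinity>\<close>.\<close>

lemma sum_gp_of_exp:
  fixes a \<sigma> :: "'d::finite \<Rightarrow> real" and s :: "'d \<Rightarrow> ereal"
  assumes \<sigma>: "\<And>j. 0 < \<sigma> j" and a: "\<And>j. 0 \<le> a j" and s: "\<And>j. s j < \<infinity>"
    and c: "c = (\<Sum>j\<in>UNIV. a j * \<sigma> j)" "0 < c"
    and U: "U = (if \<gamma> \<noteq> 0
       then ereal (1 / \<gamma>) * eln (\<Sum>j\<in>UNIV. ereal (a j * \<sigma> j / c) * eexp (ereal \<gamma> * s j))
       else (\<Sum>j\<in>UNIV. ereal (a j * \<sigma> j / c) * s j))"
  shows "(\<Sum>j\<in>UNIV. ereal (a j) * gp_of_exp (\<sigma> j) \<gamma> (s j + ereal e)) = gp_of_exp c \<gamma> (U + ereal e)"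
proof (cases "\<gamma> \<le> 0 \<and> (\<exists>j. 0 < a j \<and> s j = -\<infinity>)")
  case True
  then obtain k where k: "\<gamma> \<le> 0" "0 < a k" "s k = -\<infinity>"
    by blast
  have pk: "0 < a k * \<sigma> k / c"
    using k \<sigma> c by simp
  have Minf: "gp_of_exp \<sigma>' \<gamma> (-\<infinity>) = -\<infinity>" if "0 < \<sigma>'" for \<sigma>'
    using k(1) that by (auto simp: gp_of_exp_def one_ereal_def divide_simps)
  have "ereal (a j) * gp_of_exp (\<sigma> j) \<gamma> (s j + ereal e) < \<infinity>" for j
  proof -
    have "gp_of_exp (\<sigma> j) \<gamma> (s j + ereal e) < \<infinity>"
      using \<sigma> s by (intro gp_of_exp_less_PInfty) auto
    then show ?thesis
      using a[of j] by (cases "gp_of_exp (\<sigma> j) \<gamma> (s j + ereal e)"; cases "a j = 0") auto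
  qed
  then have L: "(\<Sum>j\<in>UNIV. ereal (a j) * gp_of_exp (\<sigma> j) \<gamma> (s j + ereal e)) = -\<infinity>"
    using k \<sigma> by (intro sum_ereal_eq_MInfty[where k = k]) (auto simp: Minf)
  have "U = -\<infinity>"
  proof (cases "\<gamma> = 0")
    case True
    have "ereal (a j * \<sigma> j / c) * s j < \<infinity>" for j
      using a[of j] \<sigma>[of j] s[of j] c(2) by (cases "s j"; cases "a j = 0") (auto simp: divide_simps)
    then have "(\<Sum>j\<in>UNIV. ereal (a j * \<sigma> j / c) * s j) = -\<infinity>"
      using k pk by (intro sum_ereal_eq_MInfty[where k = k]) auto
    then show ?thesis using True U by simp
  next
    case False
    then have "ereal (a k * \<sigma> k / c) * eexp (ereal \<gamma> * s k) = \<infinity>"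
      using k pk by auto
    then have "(\<Sum>j\<in>UNIV. ereal (a j * \<sigma> j / c) * eexp (ereal \<gamma> * s j)) = \<infinity>"
      unfolding sum_Pinfty by (intro conjI bexI[of _ k]) auto
    then show ?thesis using False k U by simp
  qed
  then show ?thesis
    using L Minf c by simp
next
  case False
  have ex: "\<exists>j. 0 < a j"
  proof (rule ccontr)
    assume "\<not> (\<exists>j. 0 < a j)"
    then have "a j = 0" for j using a[of j] by (metis less_eq_real_def)
    then show False using c by simp
  qed
  show ?thesis
  proof (cases "\<gamma> = 0")
    case True
    \<comment> \<open>For \<open>s j = -\<infinity>\<close> this is the default 0. By the case
      assumption that happens only with \<open>a j = 0\<close>, where the term vanishes on both
      sides.\<close>
    define r where "r j = real_of_ereal (s j)" for j
    have sr: "s j = ereal (r j) \<or> a j = 0" for j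
      using False True a[of j] s[of j] unfolding r_def by (cases "s j") (auto simp: less_le)
    have "ereal (a j * \<sigma> j / c) * s j = ereal (a j * \<sigma> j / c * r j)" for j
      using sr[of j] by (auto simp flip: zero_ereal_def)
    then have "U = ereal (\<Sum>j\<in>UNIV. a j * \<sigma> j / c * r j)"
      using U True by simp
    then have R: "gp_of_exp c \<gamma> (U + ereal e) = ereal (c * ((\<Sum>j\<in>UNIV. a j * \<sigma> j / c * r j) + e))"
      using True by (simp add: gp_of_exp_def)
    have "ereal (a j) * gp_of_exp (\<sigma> j) \<gamma> (s j + ereal e) = ereal (a j * (\<sigma> j * (r j + e)))" for j
      using sr[of j] True by (auto simp: gp_of_exp_def simp flip: zero_ereal_def)
    then have L: "(\<Sum>j\<in>UNIV. ereal (a j) * gp_of_exp (\<sigma> j) \<gamma> (s j + ereal e))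
        = ereal (\<Sum>j\<in>UNIV. a j * (\<sigma> j * (r j + e)))"
      by simp
    have "c * (\<Sum>j\<in>UNIV. a j * \<sigma> j / c * r j) = (\<Sum>j\<in>UNIV. a j * \<sigma> j * r j)"
      using c(2) by (simp add: sum_distrib_left)
    then have "c * ((\<Sum>j\<in>UNIV. a j * \<sigma> j / c * r j) + e) = (\<Sum>j\<in>UNIV. a j * (\<sigma> j * (r j + e)))"
      by (simp add: distrib_left sum.distrib sum_distrib_right c(1) mult.assoc)
    then show ?thesis unfolding L R by simp
  next
    case g: False
    define w where "w j = rexp (ereal \<gamma> * s j)" for j
    have w0: "0 \<le> w j" for j
      unfolding w_def by (simp add: real_of_ereal_pos)
    have sw: "eexp (ereal \<gamma> * s j) = ereal (w j) \<or> a j = 0" for j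
      using False g a[of j] s[of j] unfolding w_def
      by (cases "s j"; cases "\<gamma> > 0") (auto simp: less_le)
    have sw': "eexp (ereal \<gamma> * (s j + ereal e)) = ereal (w j * exp (\<gamma> * e)) \<or> a j = 0" for j
      using sw[of j] s[of j] g
      by (cases "s j"; cases "\<gamma> > 0") (auto simp: distrib_left exp_add)
    define W where "W = (\<Sum>j\<in>UNIV. a j * \<sigma> j / c * w j)"
    have W0: "0 \<le> W"
      unfolding W_def using a \<sigma> w0 c(2) by (intro sum_nonneg mult_nonneg_nonneg divide_nonneg_nonneg) (auto simp: less_imp_le)
    have "ereal (a j * \<sigma> j / c) * eexp (ereal \<gamma> * s j) = ereal (a j * \<sigma> j / c * w j)" for j
      using sw[of j] by (auto simp flip: zero_ereal_def)
    then have UW: "U = ereal (1 / \<gamma>) * eln (ereal W)"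
      using U g by (simp add: W_def)
    have pos: "0 < W" if "\<gamma> < 0"
    proof -
      obtain k where k: "0 < a k" using ex by blast
      then have "s k \<noteq> -\<infinity>" using False that by auto
      then have "0 < w k" using s[of k] unfolding w_def by (cases "s k") auto
      then have "0 < a k * \<sigma> k / c * w k"
        using k \<sigma> c(2) by simp
      then show ?thesis
        unfolding W_def using a \<sigma> w0 c(2)
        by (intro sum_pos2[where i = k] mult_nonneg_nonneg divide_nonneg_nonneg) (auto simp: less_imp_le)
    qed
    \<comment> \<open>By \<open>pos\<close>, \<open>W = 0\<close> is possible only for \<gamma> > 0,
      when all entries of positive weight are \<open>-\<infinity>\<close>. Then
      \<open>U = -\<infinity>\<close> and both sides are 0.\<close>
    have "eexp (ereal \<gamma> * (U + ereal e)) = ereal (W * exp (\<gamma> * e))"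
    proof (cases "W = 0")
      case True
      then have "\<gamma> > 0" using pos g by force
      then show ?thesis using True UW by simp
    next
      case False
      then have "0 < W" using W0 by simp
      then show ?thesis using UW g by (simp add: distrib_left exp_add)
    qed
    then have R: "gp_of_exp c \<gamma> (U + ereal e) = ereal (c / \<gamma> * (W * exp (\<gamma> * e) - 1))"
      using g by (simp add: gp_of_exp_def one_ereal_def)
    have "ereal (a j) * gp_of_exp (\<sigma> j) \<gamma> (s j + ereal e) = ereal (a j * (\<sigma> j / \<gamma> * (w j * exp (\<gamma> * e) - 1)))" for j
      using sw'[of j] g by (auto simp: gp_of_exp_def one_ereal_def simp flip: zero_ereal_def)
    then have L: "(\<Sum>j\<in>UNIV. ereal (a j) * gp_of_exp (\<sigma> j) \<gamma> (s j + ereal e))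
        = ereal (\<Sum>j\<in>UNIV. a j * (\<sigma> j / \<gamma> * (w j * exp (\<gamma> * e) - 1)))"
      by simp
    have "c * W = (\<Sum>j\<in>UNIV. a j * \<sigma> j * w j)"
      unfolding W_def using c(2) by (simp add: sum_distrib_left)
    then have "c / \<gamma> * (W * exp (\<gamma> * e) - 1)
        = ((\<Sum>j\<in>UNIV. a j * \<sigma> j * w j) * exp (\<gamma> * e) - (\<Sum>j\<in>UNIV. a j * \<sigma> j)) / \<gamma>"
      using c(1) by (simp add: right_diff_distrib diff_divide_distrib mult.assoc[symmetric])
    also have "\<dots> = (\<Sum>j\<in>UNIV. a j * (\<sigma> j / \<gamma> * (w j * exp (\<gamma> * e) - 1)))"
      by (simp only: sum_distrib_right sum_subtractf[symmetric] sum_divide_distrib)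
         (auto intro!: sum.cong simp: right_diff_distrib diff_divide_distrib)
    finally show ?thesis unfolding L R by simp
  qed
qed

lemma emat_vec_gp_of_exp:
  fixes A :: "real ^ 'd ^ 'm" and s :: "ereal ^ 'd"
  assumes "\<And>j. 0 < \<sigma> $ j" and "\<And>j. 0 \<le> A $ i $ j" and "\<And>j. s $ j < \<infinity>"
    and "0 < (A *v \<sigma>) $ i"
  shows "emat_vec A (\<chi> j. gp_of_exp (\<sigma> $ j) \<gamma> (s $ j + ereal e)) $ i
       = gp_of_exp ((A *v \<sigma>) $ i) \<gamma> (gp_U A \<sigma> \<gamma> s $ i + ereal e)"
  unfolding emat_vec_def vec_lambda_beta
  by (rule sum_gp_of_exp) (use assms in \<open>auto simp: gp_U_def gp_weight_def matrix_vector_mult_def\<close>)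

text \<open>The weights sum to 1, so \<open>U\<close> is a generalized mean of the entries of
  \<open>s\<close> and inherits their sign. The resulting bound \<open>rexp U \<le> 1\<close> yields
  integrability and makes \<open>Max_exp_min_diff\<close> applicable.\<close>

lemma gp_U_nonpos:
  fixes A :: "real ^ 'd ^ 'm" and s :: "ereal ^ 'd"
  assumes "\<And>j. 0 < \<sigma> $ j" and "\<And>j. 0 \<le> A $ i $ j" and "\<And>j. s $ j \<le> 0"
    and "0 < (A *v \<sigma>) $ i"
  shows "gp_U A \<sigma> \<gamma> s $ i \<le> 0"
proof -
  define p where "p = gp_weight A \<sigma> i"
  have p0: "0 \<le> p j" for j
    unfolding p_def gp_weight_def using assms(1)[of j] assms(2,4) by (intro divide_nonneg_pos) (auto simp: less_imp_le)
  have "(\<Sum>j\<in>UNIV. p j) = 1"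
    using assms(4) by (simp add: p_def gp_weight_def sum_divide_distrib[symmetric] matrix_vector_mult_def)
  then have p1: "(\<Sum>j\<in>UNIV. ereal (p j) * 1) = 1"
    by (simp add: one_ereal_def)
  have e1: "eexp x \<le> 1 \<longleftrightarrow> x \<le> 0" "1 \<le> eexp x \<longleftrightarrow> 0 \<le> x" for x
    by (cases x; simp add: one_ereal_def zero_ereal_def)+
  have l1: "x \<le> 1 \<Longrightarrow> eln x \<le> 0" "1 \<le> x \<Longrightarrow> 0 \<le> eln x" for x
    by (cases x; auto simp: one_ereal_def zero_ereal_def)+
  consider "\<gamma> = 0" | "\<gamma> > 0" | "\<gamma> < 0" by linarith
  then show ?thesis
  proof cases
    case 1
    have "(\<Sum>j\<in>UNIV. ereal (p j) * s $ j) \<le> 0"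
      using p0 assms(3) by (intro sum_nonpos) (auto simp: ereal_mult_le_0_iff)
    then show ?thesis using 1 by (simp add: gp_U_def p_def)
  next
    case 2
    have "(\<Sum>j\<in>UNIV. ereal (p j) * eexp (ereal \<gamma> * s $ j)) \<le> (\<Sum>j\<in>UNIV. ereal (p j) * 1)"
      using p0 2 assms(3) by (intro sum_mono ereal_mult_left_mono) (auto simp: e1 ereal_mult_le_0_iff)
    then have "eln (\<Sum>j\<in>UNIV. ereal (p j) * eexp (ereal \<gamma> * s $ j)) \<le> 0"
      unfolding p1 by (rule l1)
    then show ?thesis using 2 by (simp add: gp_U_def p_def ereal_mult_le_0_iff)
  next
    case 3
    have "(\<Sum>j\<in>UNIV. ereal (p j) * 1) \<le> (\<Sum>j\<in>UNIV. ereal (p j) * eexp (ereal \<gamma> * s $ j))"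
      using p0 3 assms(3) by (intro sum_mono ereal_mult_left_mono) (auto simp: e1 ereal_zero_le_0_iff)
    then have "0 \<le> eln (\<Sum>j\<in>UNIV. ereal (p j) * eexp (ereal \<gamma> * s $ j))"
      unfolding p1 by (rule l1)
    then show ?thesis using 3 by (simp add: gp_U_def p_def ereal_mult_le_0_iff)
  qed
qed

lemma measurable_gp_U [measurable]: "gp_U A \<sigma> \<gamma> \<in> borel_measurable borel"
  unfolding gp_U_def by (rule borel_measurable_vecI) simp

lemma measurable_emat_vec [measurable]: "emat_vec A \<in> borel_measurable borel"
  unfolding emat_vec_def by (rule borel_measurable_vecI) simp

section \<open>Shifts by an exponential variable\<close>

abbreviation unit_exponential :: "real measure" where
  "unit_exponential \<equiv> density lborel (exponential_density 1)"

interpretation unit_exponential: prob_space unit_exponential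
  by (rule prob_space_exponential_density) simp

lemma unit_exponential_greaterThan:
  "measure unit_exponential {e. a < e} = min 1 (exp (- a))"
proof -
  have D: "distributed unit_exponential lborel (\<lambda>x. x) (exponential_density 1)"
    by (auto simp: distributed_def distr_id2)
  have gt: "measure unit_exponential {e. b < e} = exp (- b)" if "0 \<le> b" for b
    using unit_exponential.exponential_distributedD_gt[OF D that] by simp
  show ?thesis
  proof (cases "0 \<le> a")
    case True
    then show ?thesis by (simp add: gt)
  next
    case False
    have "measure unit_exponential {e. 0 < e} \<le> measure unit_exponential {e. a < e}"
      using False by (intro unit_exponential.finite_measure_mono) auto
    then have "measure unit_exponential {e. a < e} = 1"
      using gt[of 0] by (intro antisym) auto
    then show ?thesis using False by simp
  qed
qed

text \<open>For \<open>u = -\<infinity>\<close> both sides are false. The value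
  \<open>\<infinity>\<close> must be excluded, since there \<open>rexp\<close> takes the default
  0.\<close>

lemma less_add_exp_iff:
  assumes "u < \<infinity>"
  shows "ereal t < u + ereal e \<longleftrightarrow> exp (- e) < exp (- t) * rexp u"
proof (cases u)
  case (real r)
  then have "ereal t < u + ereal e \<longleftrightarrow> - e < - t + r"
    by auto
  also have "\<dots> \<longleftrightarrow> exp (- e) < exp (- t + r)"
    by simp
  finally show ?thesis
    by (simp add: real exp_add[symmetric])
qed (use assms in auto)

lemma less_Max_range_iff:
  fixes f :: "'i::finite \<Rightarrow> 'b::linorder"
  shows "x < (MAX i. f i) \<longleftrightarrow> (\<exists>i. x < f i)"
  by (subst Max_gr_iff) auto

text \<open>The event says that \<open>exp (- e)\<close> is smaller than the maximum, and
  \<open>exp (- e)\<close> is uniform on the unit interval.\<close>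

lemma unit_exponential_shift:
  fixes u :: "ereal ^ 'm"
  assumes "\<And>i. u $ i < \<infinity>"
  shows "measure unit_exponential {e. \<exists>i. ereal (t i) < u $ i + ereal e} =
    min 1 (MAX i. exp (- t i) * rexp (u $ i))" (is "measure _ ?B = min 1 ?m")
proof -
  have B: "?B = {e. exp (- e) < ?m}"
    by (auto simp: less_add_exp_iff[OF assms] less_Max_range_iff)
  have "0 \<le> exp (- t i) * rexp (u $ i)" for i
    by simp
  then have m0: "0 \<le> ?m"
    by (meson Max_ge finite_imageI finite rangeI order_trans)
  show ?thesis
  proof (cases "?m = 0")
    case True
    then show ?thesis unfolding B by simp
  next
    case False
    then have "0 < ?m" using m0 by simp
    then have "exp (- e) < ?m \<longleftrightarrow> - ln ?m < e" for e
      by (metis exp_less_cancel_iff exp_ln minus_less_iff)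
    then have "?B = {e. - ln ?m < e}" unfolding B by simp
    then show ?thesis
      using unit_exponential_greaterThan[of "- ln ?m"] \<open>0 < ?m\<close> by simp
  qed
qed

lemma prob_exponential_shift:
  fixes U :: "'b \<Rightarrow> ereal ^ 'm"
  assumes "prob_space N" and U[measurable]: "U \<in> borel_measurable N"
    and fin: "\<And>\<omega> i. \<omega> \<in> space N \<Longrightarrow> U \<omega> $ i < \<infinity>"
  shows "measure (N \<Otimes>\<^sub>M unit_exponential)
      {q \<in> space (N \<Otimes>\<^sub>M unit_exponential). \<exists>i. ereal (t i) < U (fst q) $ i + ereal (snd q)}
    = (\<integral>\<omega>. min 1 (MAX i. exp (- t i) * rexp (U \<omega> $ i)) \<partial>N)" (is "measure ?Q ?A = integral\<^sup>L N ?f")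
proof -
  interpret N: prob_space N by fact
  have [measurable]: "?A \<in> sets ?Q"
    by measurable
  have f0: "0 \<le> ?f \<omega>" for \<omega>
  proof -
    have "0 \<le> exp (- t i) * rexp (U \<omega> $ i)" for i
      by simp
    then have "0 \<le> (MAX i. exp (- t i) * rexp (U \<omega> $ i))"
      by (meson Max_ge finite_imageI finite rangeI order_trans)
    then show ?thesis by simp
  qed
  have "emeasure ?Q ?A = (\<integral>\<^sup>+\<omega>. emeasure unit_exponential (Pair \<omega> -` ?A) \<partial>N)"
    by (rule unit_exponential.emeasure_pair_measure_alt) measurable
  also have "\<dots> = (\<integral>\<^sup>+\<omega>. ennreal (?f \<omega>) \<partial>N)"
  proof (rule nn_integral_cong)
    fix \<omega> assume \<omega>: "\<omega> \<in> space N"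
    then have "Pair \<omega> -` ?A = {e. \<exists>i. ereal (t i) < U \<omega> $ i + ereal e}"
      by (auto simp: space_pair_measure)
    then show "emeasure unit_exponential (Pair \<omega> -` ?A) = ennreal (?f \<omega>)"
      using unit_exponential_shift[of "U \<omega>" t] fin[OF \<omega>]
      by (simp add: unit_exponential.emeasure_eq_measure)
  qed
  also have "\<dots> = ennreal (integral\<^sup>L N ?f)"
    by (intro nn_integral_eq_integral N.integrable_const_bound[where B = 1])
       (use f0 in \<open>auto\<close>)
  finally show ?thesis
    by (intro measure_eq_emeasure_eq_ennreal) (auto intro!: Bochner_Integration.integral_nonneg f0)
qed

section \<open>Removing the truncation at 1\<close>

lemma Max_range_mono:
  fixes f g :: "'i::finite \<Rightarrow> 'b::linorder"
  assumes "\<And>i. f i \<le> g i"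
  shows "(MAX i. f i) \<le> (MAX i. g i)"
  by (intro Max.boundedI) (auto intro!: order_trans[OF assms Max_ge])

text \<open>Either the larger maximum is at most 1 and the truncation affects neither term, or the
  two maxima coincide and both differences vanish.\<close>

lemma Max_exp_min_diff:
  fixes t v :: "'m::finite \<Rightarrow> real"
  assumes "\<And>i. 0 \<le> v i" "\<And>i. v i \<le> 1"
  shows "min 1 (MAX i. exp (- min (t i) 0) * v i) - min 1 (MAX i. exp (- t i) * v i)
       = (MAX i. exp (- min (t i) 0) * v i) - (MAX i. exp (- t i) * v i)"
proof -
  let ?K = "MAX i. exp (- min (t i) 0) * v i" and ?M = "MAX i. exp (- t i) * v i"
  have le: "?M \<le> ?K"
    using assms by (intro Max_range_mono mult_right_mono) auto
  show ?thesis
  proof (cases "?K \<le> 1")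
    case True
    show ?thesis
      unfolding min_absorb2[OF True] min_absorb2[OF order_trans[OF le True]] by (rule refl)
  next
    case False
    text \<open>An index attaining \<open>?K > 1\<close> satisfies \<open>t < 0\<close>, and there the minimum has no effect.\<close>
    have "?K \<in> range (\<lambda>i. exp (- min (t i) 0) * v i)"
      by (intro Max_in) auto
    then obtain k where k: "?K = exp (- min (t k) 0) * v k"
      by blast
    have "t k < 0"
      using False assms(2)[of k] unfolding k by (cases "t k < 0") (auto simp: min_def split: if_splits)
    then have "?K = exp (- t k) * v k"
      using k by simp
    also have "\<dots> \<le> ?M"
      by (intro Max_ge) auto
    finally have "?K = ?M" using le by (rule antisym)
    then show ?thesis by (simp only: diff_self)
  qed
qed

lemma integrable_Max_exp_shift:
  fixes U :: "'b \<Rightarrow> ereal ^ 'm"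
  assumes "finite_measure N" and [measurable]: "U \<in> borel_measurable N"
    and nonpos: "\<And>\<omega> i. \<omega> \<in> space N \<Longrightarrow> U \<omega> $ i \<le> 0" and c: "\<And>i. 0 \<le> c i"
  shows "integrable N (\<lambda>\<omega>. MAX i. c i * rexp (U \<omega> $ i))"
proof -
  interpret finite_measure N by fact
  have "norm (MAX i. c i * rexp (U \<omega> $ i)) \<le> (MAX i. c i)" if "\<omega> \<in> space N" for \<omega>
  proof -
    have "(MAX i. c i * rexp (U \<omega> $ i)) \<in> range (\<lambda>i. c i * rexp (U \<omega> $ i))"
      by (intro Max_in) auto
    then obtain k where "(MAX i. c i * rexp (U \<omega> $ i)) = c k * rexp (U \<omega> $ k)"
      by blast
    then have "0 \<le> (MAX i. c i * rexp (U \<omega> $ i))"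
      using c by simp
    moreover have "(MAX i. c i * rexp (U \<omega> $ i)) \<le> (MAX i. c i)"
      using nonpos[OF that] c by (intro Max_range_mono) (simp add: mult_left_le rexp_le_1)
    ultimately show ?thesis by simp
  qed
  then show ?thesis
    by (intro integrable_const_bound[where B = "MAX i. c i"]) auto
qed

lemma integral_Max_exp_min_diff:
  fixes U :: "'b \<Rightarrow> ereal ^ 'm"
  assumes N: "finite_measure N" and U[measurable]: "U \<in> borel_measurable N"
    and nonpos: "\<And>\<omega> i. \<omega> \<in> space N \<Longrightarrow> U \<omega> $ i \<le> 0"
  shows "(\<integral>\<omega>. (MAX i. exp (- min (t i) 0) * rexp (U \<omega> $ i)) \<partial>N)
         - (\<integral>\<omega>. (MAX i. exp (- t i) * rexp (U \<omega> $ i)) \<partial>N)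
       = (\<integral>\<omega>. min 1 (MAX i. exp (- min (t i) 0) * rexp (U \<omega> $ i)) \<partial>N)
         - (\<integral>\<omega>. min 1 (MAX i. exp (- t i) * rexp (U \<omega> $ i)) \<partial>N)"
proof -
  interpret finite_measure N by fact
  have 1: "integrable N (\<lambda>\<omega>. MAX i. c i * rexp (U \<omega> $ i))" if "\<And>i. 0 \<le> c i" for c
    by (rule integrable_Max_exp_shift[OF N U nonpos that])
  have 2: "integrable N (\<lambda>\<omega>. min 1 (MAX i. c i * rexp (U \<omega> $ i)))" if "\<And>i. 0 \<le> c i" for c
    using 1[of c] that by (intro Bochner_Integration.integrable_min) auto
  show ?thesis
    unfolding Bochner_Integration.integral_diff[OF 1 1, OF exp_ge_zero exp_ge_zero, symmetric]
      Bochner_Integration.integral_diff[OF 2 2, OF exp_ge_zero exp_ge_zero, symmetric]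
    by (intro Bochner_Integration.integral_cong refl Max_exp_min_diff[symmetric])
       (auto intro: rexp_le_1 nonpos)
qed

section \<open>The tail formula and the conditional law\<close>

text \<open>On the original scale the cdf is prescribed only at points with
  \<open>\<sigma> + \<gamma> x > 0\<close>. On the exponential scale these become all real vectors,
  so that \<open>measure_eqI_ereal_vec_cdf\<close> applies. \<open>exp_of_gp_le_iff\<close>
  translates the events.\<close>

lemma law_exp_of_gp:
  fixes X :: "'a \<Rightarrow> ereal ^ 'd" and S :: "'b \<Rightarrow> ereal ^ 'd"
  assumes "prob_space M" and X[measurable]: "X \<in> borel_measurable M"
    and GP: "is_GP_S \<sigma> (\<chi> j. \<gamma>) N S (distr M borel X)"
  shows "distr M borel (\<lambda>\<omega>. \<chi> j. exp_of_gp (\<sigma> $ j) \<gamma> (X \<omega> $ j))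
       = distr (N \<Otimes>\<^sub>M unit_exponential) borel (\<lambda>q. \<chi> j. S (fst q) $ j + ereal (snd q))"
    (is "distr M borel ?Y = distr ?Q borel ?Z")
proof -
  interpret M: prob_space M by fact
  have srv: "spectral_random_vector N S"
    using GP unfolding is_GP_S_def by blast
  interpret N: prob_space N
    using srv unfolding spectral_random_vector_def by blast
  interpret Q: pair_prob_space N unit_exponential ..
  have S[measurable]: "S \<in> borel_measurable N"
    and nonpos: "\<And>\<omega> j. \<omega> \<in> space N \<Longrightarrow> S \<omega> $ j \<le> 0"
    and max0: "measure N {\<omega> \<in> space N. (MAX j. S \<omega> $ j) = 0} = 1"
    using srv unfolding spectral_random_vector_def by auto
  have fin: "S \<omega> $ j < \<infinity>" if "\<omega> \<in> space N" for \<omega> j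
    using nonpos[OF that, of j] by (rule le_less_trans) simp
  define \<pi> where "\<pi> = (\<chi> j. \<integral>\<omega>. rexp (S \<omega> $ j) \<partial>N)"
  define l where "l = (\<lambda>y :: real ^ 'd. \<integral>\<omega>. (MAX j. y $ j * rexp (S \<omega> $ j) / \<pi> $ j) \<partial>N)"
  have gp: "is_GP \<sigma> (\<chi> j. \<gamma>) \<pi> l (distr M borel X)"
    using GP unfolding is_GP_S_def \<pi>_def l_def Let_def by blast
  then have \<sigma>: "\<And>j. 0 < \<sigma> $ j" and \<pi>: "\<And>j. 0 < \<pi> $ j"
    and cdf: "\<And>x. (\<forall>j. 0 < \<sigma> $ j + \<gamma> * x $ j) \<Longrightarrow> measure (distr M borel X) {z. z \<le> evec x} =
        l (\<chi> j. \<pi> $ j * gp_tail \<gamma> (min (x $ j) 0 / \<sigma> $ j)) - l (\<chi> j. \<pi> $ j * gp_tail \<gamma> (x $ j / \<sigma> $ j))"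
    unfolding is_GP_def by auto
  have [measurable]: "?Y \<in> borel_measurable M" "?Z \<in> borel_measurable ?Q"
    by (rule borel_measurable_vecI; simp)+
  have [measurable]: "{z :: ereal ^ 'd. z \<le> c} \<in> sets borel" for c
    unfolding sets_borel_ereal_vec by (rule sigma_sets.Basic) blast
  \<comment> \<open>The factor \<pi> in the argument cancels the normalisation inside
    \<open>l\<close>.\<close>
  have l_eq: "l (\<chi> j. \<pi> $ j * gp_tail \<gamma> (gp_point (\<sigma> $ j) \<gamma> (t j) / \<sigma> $ j))
      = (\<integral>\<omega>. (MAX j. exp (- t j) * rexp (S \<omega> $ j)) \<partial>N)" for t
    unfolding l_def using \<pi> by (simp add: gp_tail_gp_point[OF \<sigma>] less_imp_neq[THEN not_sym])
  show ?thesis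
  proof (rule measure_eqI_ereal_vec_cdf)
    show "prob_space (distr M borel ?Y)" "prob_space (distr ?Q borel ?Z)"
      by (intro M.prob_space_distr Q.prob_space_distr; measurable)+
    show "AE z in distr ?Q borel ?Z. \<forall>j. z $ j < \<infinity>"
      by (subst AE_distr_iff) (auto simp: space_pair_measure less_imp_neq[OF fin] intro!: AE_I2)
    fix y :: "real ^ 'd"
    define x where "x = (\<chi> j. gp_point (\<sigma> $ j) \<gamma> (y $ j))"
    have "measure (distr M borel ?Y) {z. z \<le> evec y} = measure (distr M borel X) {z. z \<le> evec x}"
      by (simp add: measure_distr vimage_def less_eq_vec_def evec_def exp_of_gp_le_iff[OF \<sigma>] x_def)
    also have "\<dots> = (\<integral>\<omega>. (MAX j. exp (- min (y $ j) 0) * rexp (S \<omega> $ j)) \<partial>N)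
         - (\<integral>\<omega>. (MAX j. exp (- (y $ j)) * rexp (S \<omega> $ j)) \<partial>N)"
      by (subst cdf) (auto simp: x_def gp_point_min[OF \<sigma>] gp_point_admissible[OF \<sigma>] l_eq)
    also have "\<dots> = (\<integral>\<omega>. min 1 (MAX j. exp (- min (y $ j) 0) * rexp (S \<omega> $ j)) \<partial>N)
         - (\<integral>\<omega>. min 1 (MAX j. exp (- (y $ j)) * rexp (S \<omega> $ j)) \<partial>N)"
      by (rule integral_Max_exp_min_diff[OF N.finite_measure_axioms S nonpos])
    \<comment> \<open>Almost surely some coordinate of \<open>S\<close> is 0, and its factor
      \<open>exp (- min (y $ j) 0)\<close> is at least 1, so the truncation is active.\<close>
    also have "(\<integral>\<omega>. min 1 (MAX j. exp (- min (y $ j) 0) * rexp (S \<omega> $ j)) \<partial>N) = (\<integral>\<omega>. 1 \<partial>N)"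
    proof (rule integral_cong_AE)
      have "AE \<omega> in N. \<omega> \<in> {\<omega> \<in> space N. (MAX j. S \<omega> $ j) = 0}"
        by (subst N.prob_eq_1[symmetric]) (use max0 in auto)
      then show "AE \<omega> in N. min 1 (MAX j. exp (- min (y $ j) 0) * rexp (S \<omega> $ j)) = 1"
      proof eventually_elim
        case (elim \<omega>)
        have "(MAX j. S \<omega> $ j) \<in> range (\<lambda>j. S \<omega> $ j)"
          by (intro Max_in) auto
        then obtain k where "S \<omega> $ k = 0"
          using elim by (metis (mono_tags, lifting) imageE mem_Collect_eq)
        then have "1 \<le> exp (- min (y $ k) 0) * rexp (S \<omega> $ k)"
          by (simp add: one_ereal_def)
        also have "\<dots> \<le> (MAX j. exp (- min (y $ j) 0) * rexp (S \<omega> $ j))"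
          by (intro Max_ge) auto
        finally show ?case by (rule min_absorb1)
      qed
    qed auto
    also have "\<dots> = 1"
      by (simp add: N.prob_space)
    also have "(\<integral>\<omega>. min 1 (MAX j. exp (- (y $ j)) * rexp (S \<omega> $ j)) \<partial>N)
        = measure ?Q {q \<in> space ?Q. \<exists>j. ereal (y $ j) < S (fst q) $ j + ereal (snd q)}"
      by (rule prob_exponential_shift[OF N.prob_space_axioms S fin, symmetric])
    also have "1 - \<dots> = measure ?Q (space ?Q - {q \<in> space ?Q. \<exists>j. ereal (y $ j) < S (fst q) $ j + ereal (snd q)})"
      by (rule Q.prob_compl[symmetric]) measurable
    also have "\<dots> = measure (distr ?Q borel ?Z) {z. z \<le> evec y}"
      by (subst measure_distr) (auto simp: less_eq_vec_def evec_def simp flip: not_less intro!: arg_cong[where f = "measure ?Q"])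
    finally show "measure (distr M borel ?Y) {z. z \<le> evec y} = measure (distr ?Q borel ?Z) {z. z \<le> evec y}" .
  qed simp_all
qed

text \<open>\<open>X\<close> is almost surely a function of its image \<open>Y\<close> on the
  exponential scale, so the law of \<open>Y\<close> may be replaced by that of
  \<open>Z = S + E\<close>. There each row of \<open>A\<close> acts by
  \<open>emat_vec_gp_of_exp\<close>, and thresholds written as \<open>gp_point\<close> turn the
  event into one about \<open>U + E\<close>.\<close>

lemma prob_emat_vec_not_le:
  fixes A :: "real ^ 'd ^ 'm" and X :: "'a \<Rightarrow> ereal ^ 'd" and S :: "'b \<Rightarrow> ereal ^ 'd"
  assumes M: "prob_space M" and X[measurable]: "X \<in> borel_measurable M"
    and GP: "is_GP_S \<sigma> (\<chi> j. \<gamma>) N S (distr M borel X)"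
    and A: "\<And>i j. 0 \<le> A $ i $ j" and A\<sigma>: "\<And>i. 0 < (A *v \<sigma>) $ i"
  shows "measure M {\<omega> \<in> space M. \<not> emat_vec A (X \<omega>) \<le> evec (\<chi> i. gp_point ((A *v \<sigma>) $ i) \<gamma> (t i))}
       = (\<integral>\<omega>. min 1 (MAX i. exp (- t i) * rexp (gp_U A \<sigma> \<gamma> (S \<omega>) $ i)) \<partial>N)"
proof -
  interpret M: prob_space M by fact
  have srv: "spectral_random_vector N S"
    using GP unfolding is_GP_S_def by blast
  interpret N: prob_space N
    using srv unfolding spectral_random_vector_def by blast
  interpret Q: pair_prob_space N unit_exponential ..
  let ?Q = "N \<Otimes>\<^sub>M unit_exponential"
  have S[measurable]: "S \<in> borel_measurable N"
    and nonpos: "\<And>\<omega> j. \<omega> \<in> space N \<Longrightarrow> S \<omega> $ j \<le> 0"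
    using srv unfolding spectral_random_vector_def by auto
  have fin: "S \<omega> $ j < \<infinity>" if "\<omega> \<in> space N" for \<omega> j
    using nonpos[OF that, of j] by (rule le_less_trans) simp
  have \<sigma>: "\<And>j. 0 < \<sigma> $ j"
    and supp: "AE z in distr M borel X. gp_eta \<sigma> (\<chi> j. \<gamma>) \<le> z"
    using GP unfolding is_GP_S_def is_GP_def Let_def by auto
  define Y where "Y = (\<lambda>\<omega>. \<chi> j. exp_of_gp (\<sigma> $ j) \<gamma> (X \<omega> $ j))"
  define Z where "Z = (\<lambda>q. \<chi> j. S (fst q) $ j + ereal (snd q))"
  have Y[measurable]: "Y \<in> borel_measurable M"
    unfolding Y_def by (rule borel_measurable_vecI) simp
  have Z[measurable]: "Z \<in> borel_measurable ?Q"
    unfolding Z_def by (rule borel_measurable_vecI) simp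
  have law: "distr M borel Y = distr ?Q borel Z"
    unfolding Y_def Z_def by (rule law_exp_of_gp[OF M X GP])
  define x where "x = evec (\<chi> i. gp_point ((A *v \<sigma>) $ i) \<gamma> (t i))"
  define g where "g = (\<lambda>y :: ereal ^ 'd. emat_vec A (\<chi> j. gp_of_exp (\<sigma> $ j) \<gamma> (y $ j)))"
  have [measurable]: "g \<in> borel_measurable borel"
    unfolding g_def by (rule measurable_compose[OF borel_measurable_vecI]) simp_all
  have B[measurable]: "{y. \<not> g y \<le> x} \<in> sets borel"
  proof -
    have "{y \<in> space borel. \<not> g y \<le> x} \<in> sets borel"
      by (intro sets.sets_Collect_neg vec_le_sets_borel) auto
    then show ?thesis by simp
  qed
  have [measurable]: "{\<omega> \<in> space M. \<not> emat_vec A (X \<omega>) \<le> x} \<in> sets M"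
    by (intro sets.sets_Collect_neg vec_le_sets_borel) auto
  have [measurable]: "{\<omega> \<in> space M. \<not> g (Y \<omega>) \<le> x} \<in> sets M"
    by (intro sets.sets_Collect_neg vec_le_sets_borel) auto
  have "AE q in ?Q. \<forall>j. Z q $ j < \<infinity>"
    by (rule AE_I2) (auto simp: Z_def space_pair_measure less_imp_neq[OF fin])
  moreover have "{y \<in> space borel. \<forall>j. (y :: ereal ^ 'd) $ j < \<infinity>} \<in> sets borel"
    by measurable
  ultimately have "AE y in distr ?Q borel Z. \<forall>j. y $ j < \<infinity>"
    by (simp only: AE_distr_iff[OF Z])
  \<comment> \<open>Equality of laws carries finiteness from \<open>Z\<close> to \<open>Y\<close>.
    For \<gamma> < 0 this keeps \<open>X\<close> below its upper endpoint.\<close>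
  then have "AE \<omega> in M. \<forall>j. Y \<omega> $ j < \<infinity>"
    unfolding law[symmetric] by (rule AE_distrD[OF Y])
  moreover have "AE \<omega> in M. gp_eta \<sigma> (\<chi> j. \<gamma>) \<le> X \<omega>"
    by (rule AE_distrD[OF X supp])
  ultimately have "AE \<omega> in M. emat_vec A (X \<omega>) = g (Y \<omega>)"
  proof eventually_elim
    case (elim \<omega>)
    have "gp_of_exp (\<sigma> $ j) \<gamma> (Y \<omega> $ j) = X \<omega> $ j" for j
    proof -
      have "ereal (- \<sigma> $ j / \<gamma>) \<le> X \<omega> $ j" if "0 < \<gamma>"
        using elim(2) that by (auto simp: less_eq_vec_def gp_eta_def dest: spec[of _ j])
      moreover have "exp_of_gp (\<sigma> $ j) \<gamma> (X \<omega> $ j) < \<infinity>"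
        using elim(1) by (auto simp: Y_def)
      ultimately have "gp_of_exp (\<sigma> $ j) \<gamma> (exp_of_gp (\<sigma> $ j) \<gamma> (X \<omega> $ j)) = X \<omega> $ j"
        by (rule gp_of_exp_exp_of_gp[OF \<sigma>])
      then show ?thesis
        by (simp add: Y_def)
    qed
    then show ?case
      by (simp add: g_def)
  qed
  then have "measure M {\<omega> \<in> space M. \<not> emat_vec A (X \<omega>) \<le> x} = measure M {\<omega> \<in> space M. \<not> g (Y \<omega>) \<le> x}"
    by (intro M.finite_measure_eq_AE) auto
  also have "\<dots> = measure (distr M borel Y) {y. \<not> g y \<le> x}"
    by (subst measure_distr) (auto intro!: arg_cong[where f = "measure M"])
  also have "\<dots> = measure ?Q {q \<in> space ?Q. \<not> g (Z q) \<le> x}"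
    unfolding law by (subst measure_distr) (auto intro!: arg_cong[where f = "measure ?Q"])
  also have "{q \<in> space ?Q. \<not> g (Z q) \<le> x}
      = {q \<in> space ?Q. \<exists>i. ereal (t i) < gp_U A \<sigma> \<gamma> (S (fst q)) $ i + ereal (snd q)}"
  proof (intro Collect_cong conj_cong refl)
    fix q assume "q \<in> space ?Q"
    then have q: "fst q \<in> space N" by (auto simp: space_pair_measure)
    have "g (Z q) $ i = gp_of_exp ((A *v \<sigma>) $ i) \<gamma> (gp_U A \<sigma> \<gamma> (S (fst q)) $ i + ereal (snd q))" for i
      using emat_vec_gp_of_exp[OF \<sigma> A fin[OF q] A\<sigma>, of \<gamma> "snd q" i] by (simp add: g_def Z_def)
    then show "(\<not> g (Z q) \<le> x) = (\<exists>i. ereal (t i) < gp_U A \<sigma> \<gamma> (S (fst q)) $ i + ereal (snd q))"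
      by (simp add: less_eq_vec_def x_def evec_def gp_of_exp_le_gp_point_iff[OF A\<sigma>] not_le)
  qed
  also have "measure ?Q \<dots> = (\<integral>\<omega>. min 1 (MAX i. exp (- t i) * rexp (gp_U A \<sigma> \<gamma> (S \<omega>) $ i)) \<partial>N)"
  proof (rule prob_exponential_shift[OF N.prob_space_axioms])
    show "(\<lambda>\<omega>. gp_U A \<sigma> \<gamma> (S \<omega>)) \<in> borel_measurable N"
      by measurable
    show "gp_U A \<sigma> \<gamma> (S \<omega>) $ i < \<infinity>" if "\<omega> \<in> space N" for \<omega> i
      using gp_U_nonpos[OF \<sigma> A nonpos[OF that] A\<sigma>, of \<gamma> i] by (rule le_less_trans) simp
  qed
  finally show ?thesis
    unfolding x_def .
qed

text \<open>\<open>rexp\<close> is monotone only away from \<open>\<infinity>\<close>, where it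
  drops to 0.\<close>

lemma rexp_Max:
  fixes u :: "'m::finite \<Rightarrow> ereal"
  assumes "\<And>i. u i < \<infinity>"
  shows "rexp (MAX i. u i) = (MAX i. rexp (u i))"
proof (rule antisym)
  have "(MAX i. u i) \<in> range u"
    by (intro Max_in) auto
  then obtain k where k: "(MAX i. u i) = u k"
    by blast
  then show "rexp (MAX i. u i) \<le> (MAX i. rexp (u i))"
    by (auto intro: Max_ge)
  have "rexp (u i) \<le> rexp (u k)" for i
  proof -
    have "u i \<le> u k"
      unfolding k[symmetric] by (intro Max_ge) auto
    then show ?thesis
      using assms[of i] assms[of k] by (cases "u i"; cases "u k") auto
  qed
  then show "(MAX i. rexp (u i)) \<le> rexp (MAX i. u i)"
    unfolding k by (intro Max.boundedI) auto
qed

lemma Max_range_divide_right: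
  fixes f :: "'i::finite \<Rightarrow> real"
  assumes "0 \<le> c"
  shows "(MAX i. f i / c) = (MAX i. f i) / c"
proof -
  have "mono (\<lambda>x :: real. x / c)"
    using assms by (intro monoI divide_right_mono)
  from mono_Max_commute[OF this, of "range f"] show ?thesis
    by (simp add: image_image)
qed

theorem proposition9p1:
  fixes M :: "'a measure" and N :: "'b measure"
    and X :: "'a \<Rightarrow> ereal ^ 'd" and S :: "'b \<Rightarrow> ereal ^ 'd"
    and \<sigma> :: "real ^ 'd" and \<gamma> :: real and A :: "real ^ 'd ^ 'm"
  assumes "prob_space M" and "X \<in> borel_measurable M"
    and "spectral_random_vector N S"
    and "is_GP_S \<sigma> (\<chi> j. \<gamma>) N S (distr M borel X)"
    and "\<And>i j. 0 \<le> A $ i $ j"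
    and "\<And>i. measure M {\<omega> \<in> space M. emat_vec A (X \<omega>) $ i > 0} > 0"
  shows "(\<forall>x :: real ^ 'm. (\<forall>i. (A *v \<sigma>) $ i + \<gamma> * x $ i > 0) \<longrightarrow>
            measure M {\<omega> \<in> space M. \<not> emat_vec A (X \<omega>) \<le> evec x} =
            (\<integral>\<omega>. min 1 (MAX i. gp_tail \<gamma> (x $ i / (A *v \<sigma>) $ i) * rexp (gp_U A \<sigma> \<gamma> (S \<omega>) $ i)) \<partial>N)) \<and>
         is_GP_U (A *v \<sigma>) (\<chi> i. \<gamma>) N (\<lambda>\<omega>. gp_U A \<sigma> \<gamma> (S \<omega>))
           (distr (uniform_measure M {\<omega> \<in> space M. \<not> emat_vec A (X \<omega>) \<le> evec 0})
              borel (\<lambda>\<omega>. emat_vec A (X \<omega>)))"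
proof -
  interpret M: prob_space M by fact
  note X[measurable] = assms(2)
  note A = assms(5)
  interpret N: prob_space N
    using assms(3) unfolding spectral_random_vector_def by blast
  have S[measurable]: "S \<in> borel_measurable N"
    and nonpos: "\<And>\<omega> j. \<omega> \<in> space N \<Longrightarrow> S \<omega> $ j \<le> 0"
    using assms(3) unfolding spectral_random_vector_def by auto
  have \<sigma>: "\<And>j. 0 < \<sigma> $ j"
    and supp: "AE z in distr M borel X. gp_eta \<sigma> (\<chi> j. \<gamma>) \<le> z \<and> (\<forall>j. z $ j < \<infinity>)"
    using assms(4) unfolding is_GP_S_def is_GP_def Let_def by auto
  have supp: "AE \<omega> in M. gp_eta \<sigma> (\<chi> j. \<gamma>) \<le> X \<omega> \<and> (\<forall>j. X \<omega> $ j < \<infinity>)"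
    by (rule AE_distrD[OF X supp])
  define c where "c = A *v \<sigma>"
  have c: "0 < c $ i" for i
  proof -
    have "\<exists>j. A $ i $ j \<noteq> 0"
    proof (rule ccontr)
      assume "\<nexists>j. A $ i $ j \<noteq> 0"
      \<comment> \<open>Zero coefficients annihilate even infinite entries, so a zero row could
        never give a positive value.\<close>
      then have "emat_vec A (X \<omega>) $ i = 0" for \<omega>
        by (simp add: emat_vec_def flip: zero_ereal_def)
      then show False using assms(6)[of i] by simp
    qed
    then obtain j where "0 < A $ i $ j"
      using A by (metis less_eq_real_def)
    then have "0 < (\<Sum>j\<in>UNIV. A $ i $ j * \<sigma> $ j)"
      using A \<sigma> by (intro sum_pos2[where i = j]) (auto simp: less_imp_le)
    then show ?thesis by (simp add: c_def matrix_vector_mult_def)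
  qed
  define U where "U \<omega> = gp_U A \<sigma> \<gamma> (S \<omega>)" for \<omega>
  have U[measurable]: "U \<in> borel_measurable N"
    unfolding U_def by measurable
  have Unonpos: "U \<omega> $ i \<le> 0" if "\<omega> \<in> space N" for \<omega> i
    unfolding U_def by (rule gp_U_nonpos[OF \<sigma> A nonpos[OF that] c[unfolded c_def]])
  have Ufin: "U \<omega> $ i < \<infinity>" if "\<omega> \<in> space N" for \<omega> i
    using Unonpos[OF that, of i] by (rule le_less_trans) simp
  define W where "W \<omega> = emat_vec A (X \<omega>)" for \<omega>
  have W[measurable]: "W \<in> borel_measurable M"
    unfolding W_def by measurable
  have not_le_sets[measurable]: "{\<omega> \<in> space M. \<not> W \<omega> \<le> evec x} \<in> sets M" for x
    by (intro sets.sets_Collect_neg vec_le_sets_borel) auto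
  \<comment> \<open>All admissible thresholds have this form, and at \<open>pt t\<close> the factors
    \<open>gp_tail\<close> become \<open>exp (- t i)\<close>.\<close>
  define pt where "pt t = (\<chi> i. gp_point (c $ i) \<gamma> (t i))" for t
  have tail: "measure M {\<omega> \<in> space M. \<not> W \<omega> \<le> evec (pt t)}
      = (\<integral>\<omega>. min 1 (MAX i. exp (- t i) * rexp (U \<omega> $ i)) \<partial>N)" for t
    unfolding W_def pt_def U_def c_def
    by (rule prob_emat_vec_not_le[OF assms(1,2,4) A c[unfolded c_def]])
  have pt_surj: "\<exists>t. x = pt t" if "\<forall>i. 0 < c $ i + \<gamma> * x $ i" for x
  proof -
    have "\<forall>i. \<exists>t. x $ i = gp_point (c $ i) \<gamma> t"
      using gp_point_surj[OF c] that by metis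
    then obtain t where "\<And>i. x $ i = gp_point (c $ i) \<gamma> (t i)"
      by metis
    then show ?thesis
      by (auto simp: pt_def vec_eq_iff intro!: exI[of _ t])
  qed
  have formula: "measure M {\<omega> \<in> space M. \<not> W \<omega> \<le> evec x}
      = (\<integral>\<omega>. min 1 (MAX i. gp_tail \<gamma> (x $ i / c $ i) * rexp (U \<omega> $ i)) \<partial>N)"
    if x: "\<forall>i. 0 < c $ i + \<gamma> * x $ i" for x
  proof -
    obtain t where "x = pt t" using pt_surj[OF x] by blast
    then show ?thesis
      using tail[of t] by (simp add: pt_def gp_tail_gp_point[OF c])
  qed

  \<comment> \<open>Parameters and cdf of the conditional law\<close>
  define e where "e i = (\<integral>\<omega>. rexp (U \<omega> $ i) \<partial>N)" for i
  define emax where "emax = (\<integral>\<omega>. rexp (MAX k. U \<omega> $ k) \<partial>N)"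
  define \<pi> where "\<pi> = (\<chi> i. e i / emax)"
  define l where "l = (\<lambda>y :: real ^ 'm. \<integral>\<omega>. (MAX i. y $ i * rexp (U \<omega> $ i) / e i) \<partial>N)"
  have int: "integrable N (\<lambda>\<omega>. rexp (U \<omega> $ i))" for i
    by (rule N.integrable_const_bound[where B = 1]) (auto intro: rexp_le_1 Unonpos)
  have intMax: "integrable N (\<lambda>\<omega>. MAX i. a i * rexp (U \<omega> $ i))" if "\<And>i. 0 \<le> a i" for a
    by (rule integrable_Max_exp_shift[OF N.finite_measure_axioms U Unonpos that])
  have emax_eq: "emax = (\<integral>\<omega>. (MAX i. rexp (U \<omega> $ i)) \<partial>N)"
    unfolding emax_def by (intro Bochner_Integration.integral_cong refl rexp_Max Ufin)
  have e_pos: "0 < e i" for i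
  proof -
    text \<open>Compare \<open>W\<^sub>i > 0\<close> with the tail event whose thresholds in the other coordinates are large.\<close>
    define p where "p = measure M {\<omega> \<in> space M. W \<omega> $ i > 0}"
    have p: "0 < p"
      using assms(6)[of i] by (simp add: p_def W_def)
    \<comment> \<open>Chosen so that \<open>exp (- s) = p / exp 1\<close>, strictly less than
      \<open>p\<close>: the other coordinates cannot account for the whole probability.\<close>
    define s where "s = 1 - ln p"
    define t where "t k = (if k = i then 0 else s)" for k
    have "p \<le> measure M {\<omega> \<in> space M. \<not> W \<omega> \<le> evec (pt t)}"
      unfolding p_def
      by (rule M.finite_measure_mono)
         (auto simp: less_eq_vec_def evec_def pt_def t_def zero_ereal_def not_le
           intro!: exI[of _ i] not_le_sets)
    also have "\<dots> = (\<integral>\<omega>. min 1 (MAX k. exp (- t k) * rexp (U \<omega> $ k)) \<partial>N)"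
      by (rule tail)
    also have "\<dots> \<le> (\<integral>\<omega>. exp (- s) + rexp (U \<omega> $ i) \<partial>N)"
    proof (rule integral_mono)
      show "integrable N (\<lambda>\<omega>. min 1 (MAX k. exp (- t k) * rexp (U \<omega> $ k)))"
        using intMax[of "\<lambda>k. exp (- t k)"] by (intro Bochner_Integration.integrable_min) auto
      show "integrable N (\<lambda>\<omega>. exp (- s) + rexp (U \<omega> $ i))"
        using int by simp
      fix \<omega> assume \<omega>: "\<omega> \<in> space N"
      have "exp (- t k) * rexp (U \<omega> $ k) \<le> exp (- s) + rexp (U \<omega> $ i)" for k
        using rexp_le_1[OF Unonpos[OF \<omega>, of k]]
        by (auto simp: t_def intro: order_trans[OF mult_left_le] add_increasing2)
      then have "(MAX k. exp (- t k) * rexp (U \<omega> $ k)) \<le> exp (- s) + rexp (U \<omega> $ i)"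
        by (intro Max.boundedI) auto
      then show "min 1 (MAX k. exp (- t k) * rexp (U \<omega> $ k)) \<le> exp (- s) + rexp (U \<omega> $ i)"
        by (rule min.coboundedI2)
    qed
    also have "\<dots> = exp (- s) + e i"
      using int by (simp add: e_def N.prob_space)
    finally have "p \<le> exp (- s) + e i" .
    moreover have "exp (- s) < p"
      using p by (simp add: s_def exp_diff divide_less_eq)
    ultimately show ?thesis by simp
  qed
  have e_le: "e i \<le> emax" for i
    unfolding e_def emax_eq
    using intMax[of "\<lambda>_. 1"] int by (intro integral_mono) auto
  have emax_pos: "0 < emax"
    using e_pos e_le by (rule less_le_trans)
  \<comment> \<open>Since \<open>\<pi> $ i / e i = 1 / emax\<close> for every \<open>i\<close>, the
    coordinatewise normalisations merge into one constant.\<close>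
  have l_eq: "l (\<chi> i. \<pi> $ i * a i) = (\<integral>\<omega>. (MAX i. a i * rexp (U \<omega> $ i)) \<partial>N) / emax" for a
  proof -
    have "\<pi> $ i * a i * rexp (U \<omega> $ i) / e i = a i * rexp (U \<omega> $ i) / emax" for i \<omega>
      using e_pos[of i] by (simp add: \<pi>_def)
    then show ?thesis
      unfolding l_def using emax_pos by (simp add: Max_range_divide_right)
  qed
  \<comment> \<open>All thresholds \<open>t i\<close> are 0 and \<open>U \<le> 0\<close>, so the
    truncation is inactive. The probability of the conditioning event is thus the very normalisation
    in \<pi>.\<close>
  have event: "measure M {\<omega> \<in> space M. \<not> W \<omega> \<le> evec 0} = emax"
  proof -
    have "pt (\<lambda>_. 0) = 0" by (simp add: pt_def vec_eq_iff)
    then have "measure M {\<omega> \<in> space M. \<not> W \<omega> \<le> evec 0} = (\<integral>\<omega>. min 1 (MAX i. rexp (U \<omega> $ i)) \<partial>N)"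
      using tail[of "\<lambda>_. 0"] by simp
    also have "\<dots> = emax"
      unfolding emax_eq by (intro Bochner_Integration.integral_cong refl min_absorb2 Max.boundedI) (auto intro: rexp_le_1 Unonpos)
    finally show ?thesis .
  qed
  let ?E = "{\<omega> \<in> space M. \<not> W \<omega> \<le> evec 0}"
  have le_sets[measurable]: "{z :: ereal ^ 'm. z \<le> x} \<in> sets borel" for x
    unfolding sets_borel_ereal_vec by (rule sigma_sets.Basic) blast
  have emeasE: "emeasure M ?E \<noteq> 0" "emeasure M ?E \<noteq> \<infinity>"
    unfolding M.emeasure_eq_measure event using emax_pos by simp_all
  define R where "R = uniform_measure M ?E"
  interpret R: prob_space R
    unfolding R_def by (rule prob_space_uniform_measure[OF emeasE])
  have setsR: "sets R = sets M" unfolding R_def by simp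
  note [measurable_cong] = setsR
  have spR: "space R = space M" unfolding R_def by simp
  have WR: "W \<in> borel_measurable R" by measurable
  define D where "D = distr R borel W"

  have stdf: "stdf l"
    unfolding stdf_def
  proof (intro exI conjI allI impI)
    \<comment> \<open>The generator of the stdf: exponentials of \<open>U\<close> scaled to have
      mean 1.\<close>
    let ?v = "\<lambda>\<omega>. \<chi> i. rexp (U \<omega> $ i) / e i"
    have v[measurable]: "?v \<in> borel_measurable N"
      by (rule borel_measurable_vecI) simp
    show "prob_space (distr N borel ?v)"
      by (rule N.prob_space_distr[OF v])
    show "sets (distr N borel ?v) = sets borel" by simp
    show "AE v in distr N borel ?v. \<forall>j. 0 \<le> v $ j"
      using e_pos by (subst AE_distr_iff) (auto intro!: divide_nonneg_pos)
    show "integrable (distr N borel ?v) (\<lambda>v. v $ j)" for j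
      using int by (subst integrable_distr_eq) auto
    show "(\<integral>v. v $ j \<partial>distr N borel ?v) = 1" for j
      using e_pos[of j, THEN less_imp_neq] by (subst integral_distr[OF v]) (simp_all flip: e_def)
    show "l y = (\<integral>v. (MAX j. y $ j * v $ j) \<partial>distr N borel ?v)" for y
      unfolding l_def by (subst integral_distr[OF v]) simp_all
  qed

  have cdf: "measure D {z. z \<le> evec x} =
      l (\<chi> i. \<pi> $ i * gp_tail \<gamma> (min (x $ i) 0 / c $ i)) - l (\<chi> i. \<pi> $ i * gp_tail \<gamma> (x $ i / c $ i))"
    if x: "\<forall>i. 0 < c $ i + \<gamma> * x $ i" for x
  proof -
    obtain t where t: "x = pt t" using pt_surj[OF x] by blast
    \<comment> \<open>This is \<open>min x 0\<close> written on the \<open>t\<close> scale, because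
      \<open>gp_point\<close> is increasing and fixes 0. The conditional cdf at \<open>x\<close> is
      a difference of the tails at \<open>x0\<close> and \<open>x\<close>, divided by
      \<open>emax\<close>.\<close>
    define x0 where "x0 = pt (\<lambda>i. min (t i) 0)"
    have x0: "x0 $ i = min (x $ i) 0" for i
      by (simp add: x0_def t pt_def gp_point_min[OF c])
    have le_min: "a \<le> ereal (min r s) \<longleftrightarrow> a \<le> ereal r \<and> a \<le> ereal s" for a r s
      by (cases a) auto
    let ?F = "\<lambda>x. {\<omega> \<in> space M. \<not> W \<omega> \<le> evec x}"
    have "measure D {z. z \<le> evec x} = measure R {\<omega> \<in> space M. W \<omega> \<le> evec x}"
      unfolding D_def by (subst measure_distr[OF WR]) (auto simp: spR intro!: arg_cong[where f = "measure R"])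
    also have "\<dots> = measure M (?E \<inter> {\<omega> \<in> space M. W \<omega> \<le> evec x}) / emax"
      unfolding R_def event[symmetric]
      by (rule measure_uniform_measure[OF emeasE]) (intro vec_le_sets_borel; simp)
    also have "?E \<inter> {\<omega> \<in> space M. W \<omega> \<le> evec x} = ?F x0 - ?F x"
    proof -
      have "w \<le> evec x0 \<longleftrightarrow> w \<le> evec x \<and> w \<le> evec 0" for w :: "ereal ^ 'm"
        by (auto simp: less_eq_vec_def evec_def x0 le_min)
      then show ?thesis by blast
    qed
    also have "measure M (?F x0 - ?F x) = measure M (?F x0) - measure M (?F x)"
    proof (rule M.finite_measure_Diff)
      have "w \<le> evec x0 \<Longrightarrow> w \<le> evec x" for w :: "ereal ^ 'm"
        by (auto simp: less_eq_vec_def evec_def x0 le_min)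
      then show "?F x \<subseteq> ?F x0" by blast
    qed measurable
    \<comment> \<open>Passing to untruncated maxima leaves the difference unchanged, and these are
      what \<open>l_eq\<close> identifies as values of \<open>l\<close>.\<close>
    also have "\<dots> = (\<integral>\<omega>. (MAX i. exp (- min (t i) 0) * rexp (U \<omega> $ i)) \<partial>N)
         - (\<integral>\<omega>. (MAX i. exp (- t i) * rexp (U \<omega> $ i)) \<partial>N)"
      unfolding x0_def t tail
      by (rule integral_Max_exp_min_diff[OF N.finite_measure_axioms U Unonpos, symmetric])
    also have "\<dots> / emax = l (\<chi> i. \<pi> $ i * exp (- min (t i) 0)) - l (\<chi> i. \<pi> $ i * exp (- t i))"
      by (simp only: l_eq diff_divide_distrib)
    also have "\<dots> = l (\<chi> i. \<pi> $ i * gp_tail \<gamma> (min (x $ i) 0 / c $ i)) - l (\<chi> i. \<pi> $ i * gp_tail \<gamma> (x $ i / c $ i))"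
      by (simp add: t pt_def gp_point_min[OF c] gp_tail_gp_point[OF c])
    finally show ?thesis .
  qed

  have suppD: "AE z in D. (\<forall>i. z $ i < \<infinity>) \<and> gp_eta c (\<chi> i. \<gamma>) \<le> z \<and> (\<exists>i. 0 < z $ i)"
  proof -
    have "AE \<omega> in R. \<omega> \<in> ?E"
      unfolding R_def by (rule AE_uniform_measureI) auto
    moreover have "AE \<omega> in R. gp_eta \<sigma> (\<chi> j. \<gamma>) \<le> X \<omega> \<and> (\<forall>j. X \<omega> $ j < \<infinity>)"
      unfolding R_def by (rule AE_uniform_measureI) (use supp in auto)
    ultimately have "AE \<omega> in R. (\<forall>i. W \<omega> $ i < \<infinity>) \<and> gp_eta c (\<chi> i. \<gamma>) \<le> W \<omega> \<and> (\<exists>i. 0 < W \<omega> $ i)"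
    proof eventually_elim
      case (elim \<omega>)
      have "\<exists>i. 0 < W \<omega> $ i"
        using elim(1) by (auto simp: less_eq_vec_def evec_def zero_ereal_def not_le)
      moreover have "W \<omega> $ i < \<infinity>" for i
      proof -
        have "ereal (A $ i $ j) * X \<omega> $ j \<noteq> \<infinity>" for j
          using elim(2) A[of i j] by (cases "X \<omega> $ j"; cases "A $ i $ j = 0") (auto simp flip: zero_ereal_def)
        then show ?thesis
          by (simp add: W_def emat_vec_def sum_Pinfty)
      qed
      moreover have "gp_eta c (\<chi> i. \<gamma>) $ i \<le> W \<omega> $ i" for i
      proof (cases "0 < \<gamma>")
        case True
        \<comment> \<open>With a common \<gamma> > 0 the lower endpoints combine linearly, and
          nonnegative coefficients preserve the bounds.\<close>
        have "ereal (- c $ i / \<gamma>) = (\<Sum>j\<in>UNIV. ereal (A $ i $ j) * ereal (- \<sigma> $ j / \<gamma>))"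
          by (simp add: c_def matrix_vector_mult_def sum_negf sum_divide_distrib)
        also have "\<dots> \<le> (\<Sum>j\<in>UNIV. ereal (A $ i $ j) * X \<omega> $ j)"
        proof (intro sum_mono ereal_mult_left_mono)
          show "ereal (- \<sigma> $ j / \<gamma>) \<le> X \<omega> $ j" for j
            using elim(2) True by (auto simp: less_eq_vec_def gp_eta_def dest: spec[of _ j])
        qed (use A in auto)
        finally show ?thesis using True by (simp add: gp_eta_def W_def emat_vec_def)
      qed (simp add: gp_eta_def)
      ultimately show ?case by (auto simp: less_eq_vec_def)
    qed
    moreover have "{z \<in> space borel. (\<forall>i. z $ i < \<infinity>) \<and> gp_eta c (\<chi> i. \<gamma>) \<le> z \<and> (\<exists>i. 0 < z $ i)} \<in> sets borel"
      unfolding less_eq_vec_def by measurable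
    ultimately show ?thesis
      unfolding D_def by (simp only: AE_distr_iff[OF WR])
  qed

  have "is_GP c (\<chi> i. \<gamma>) \<pi> l D"
    unfolding is_GP_def
  proof (intro conjI)
    show "\<forall>j. 0 < c $ j" using c by blast
    show "\<forall>j. 0 < \<pi> $ j \<and> \<pi> $ j \<le> 1"
      using e_pos e_le emax_pos by (simp add: \<pi>_def)
    show "stdf l" by (rule stdf)
    show "l \<pi> = 1"
      using l_eq[of "\<lambda>_. 1"] emax_pos by (simp add: emax_eq)
    show "prob_space D" unfolding D_def by (rule R.prob_space_distr[OF WR])
    show "sets D = sets borel" unfolding D_def by simp
    show "AE x in D. (\<forall>j. x $ j < \<infinity>) \<and> gp_eta c (\<chi> i. \<gamma>) \<le> x \<and> (\<exists>j. 0 < x $ j)"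
      by (rule suppD)
  qed (use cdf in simp)
  moreover have "exp_integrable_vector N U"
    unfolding exp_integrable_vector_def using N.prob_space_axioms U Ufin int e_pos
    by (auto simp: e_def)
  ultimately have "is_GP_U c (\<chi> i. \<gamma>) N U D"
    unfolding is_GP_U_def Let_def \<pi>_def l_def e_def emax_def by blast
  then show ?thesis
    using formula unfolding D_def R_def W_def[abs_def] U_def[abs_def] c_def by blast
qed

end
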